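(* Let $n=2m+1$ with $m\in\mathbb N$, and let $\mathcal T\in\mathfrak T_n$ be fixed. Then $\mathcal D_F=\mathcal D_{\tilde F}$ for any $F,\tilde F\in\mathfrak F(\mathcal T)$.
   Context: All functions are complex-valued. $n=2m+1$, $m\in\mathbb N$. $\mathfrak D=C_0^\infty(0,1)$, $\mathfrak D'$ is the space of distributions on $(0,1)$. For $i\ge 0$, $W_1^{-i}[0,1]$ is the set of distributions $\sigma^{(i)}$ with $\sigma\in L_1[0,1]$ ($W_1^0=L_1$). Singularity orders: $i_{2k+j}:=m-k-j$ for $k\ge 0$, $j\in\{0,1\}$. Coefficient space: $\mathfrak T_n:=\{\mathcal T=(\tau_\nu)_{\nu=0}^{n-1}:\tau_\nu\in W_1^{-i_\nu}[0,1],\ \nu=0,\dots,n-1\}$. Differential expression with coefficients $\mathcal T$: $$\ell_n(y)=y^{(n)}+\sum_{k=0}^{m}(-1)^k(\tau_{2k}y^{(k)})^{(k)}+\sum_{k=0}^{m-1}(-1)^{k+1}\Bigl((\tau_{2k+1}y^{(k)})^{(k+1)}+(\tau_{2k+1}y^{(k+1)})^{(k)}\Bigr),$$ understood in $\mathfrak D'$; the product of $\tau=\sigma^{(i)}$, $\sigma\in L_1[0,1]$, and $g\in W_1^{i+1}[0,1]$ is $(\tau g,z)=(-1)^i\int_0^1\sigma\,(gz)^{(i)}\,dx$, $z\in\mathfrak D$. $\mathfrak F_n$ is the set of $n\times n$ matrix functions $F=[f_{k,j}]_{k,j=1}^n$ on $[0,1]$ such that $f_{k,j}\in L_1[0,1]$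 for $k=m+1,\dots,2m+1$, $j=1,\dots,m+1$, and $f_{k,j}=0$ whenever $k<m+1$ or $j>m+1$. For $F\in\mathfrak F_n$ the quasi-derivatives are $y^{[0]}:=y$, $y^{[k]}:=(y^{[k-1]})'-\sum_{j=1}^k f_{k,j}y^{[j-1]}$, $k=1,\dots,n$, and $\mathcal D_F:=\{y: y^{[k]}\in W_1^1[0,1],\ k=0,\dots,n-1\}$ (so $\mathcal D_F\subset W_1^{m+1}[0,1]$). $F\in\mathfrak F_n$ is called associated with $\ell_n(y)$ if $\ell_n(y)=y^{[n]}$ for every $y\in\mathcal D_F$. $\mathfrak F(\mathcal T)\subset\mathfrak F_n$ is the set of all matrices associated with the expression $\ell_n$ having coefficients $\mathcal T$. *)

theory Defs
  imports "HOL-Analysis.Analysis"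
begin

text \<open>
  Functions on $[0,1]$ are total functions on the reals of which only the values on
  \<^term>\<open>{0..1::real}\<close> matter, and distributions on $(0,1)$ are functionals of which only the
  values on \<open>test_funs\<close> matter. Elements of \<open>L1\<close> are representatives of classes modulo equality
  almost everywhere; apart from the pointwise vanishing of entries in \<open>matrix_class\<close>, everything
  below is insensitive to the choice of representative.
\<close>

definition L1 :: "(real \<Rightarrow> complex) set" where
  "L1 = {f. f absolutely_integrable_on {0..1}}"


subsection \<open>Distributions\<close>

definition cderiv :: "(real \<Rightarrow> complex) \<Rightarrow> real \<Rightarrow> complex" where
  "cderiv f = (\<lambda>x. vector_derivative f (at x))"

definition test_funs :: "(real \<Rightarrow> complex) set" where
  "test_funs = {z. (\<forall>k x. ((cderiv ^^ k) z) differentiable (at x)) \<and>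
                   (\<exists>K. compact K \<and> K \<subseteq> {0<..<1} \<and> (\<forall>x. x \<notin> K \<longrightarrow> z x = 0))}"

type_synonym distr = "(real \<Rightarrow> complex) \<Rightarrow> complex"

definition distr_eq :: "distr \<Rightarrow> distr \<Rightarrow> bool"  (infix "\<doteq>" 50) where
  "S \<doteq> T \<longleftrightarrow> (\<forall>z\<in>test_funs. S z = T z)"

definition distr_of :: "(real \<Rightarrow> complex) \<Rightarrow> distr" where
  "distr_of f = (\<lambda>z. integral {0..1} (\<lambda>x. f x * z x))"

definition distr_deriv :: "distr \<Rightarrow> distr" where
  "distr_deriv T = (\<lambda>z. - T (cderiv z))"

text \<open>
  The space $W_1^{-i}[0,1]$. Linearity and continuity on the test functions need not be required,
  since they are inherited from $\sigma^{(i)}$.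
\<close>

definition W1_neg :: "nat \<Rightarrow> distr set" where
  "W1_neg i = {T. \<exists>\<sigma>\<in>L1. T \<doteq> (distr_deriv ^^ i) (distr_of \<sigma>)}"


subsection \<open>Sobolev derivatives and products\<close>

definition has_L1_deriv :: "(real \<Rightarrow> complex) \<Rightarrow> (real \<Rightarrow> complex) \<Rightarrow> bool" where
  "has_L1_deriv u g \<longleftrightarrow> g \<in> L1 \<and> distr_deriv (distr_of u) \<doteq> distr_of g"

text \<open>The space $W_1^1[0,1]$.\<close>

definition W11 :: "(real \<Rightarrow> complex) set" where
  "W11 = {u \<in> L1. \<exists>g. has_L1_deriv u g}"

text \<open>A representative of $u'$ for $u \in W_1^1[0,1]$; it is unique almost everywhere.\<close>

definition L1_deriv :: "(real \<Rightarrow> complex) \<Rightarrow> real \<Rightarrow> complex" where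
  "L1_deriv u = (SOME g. has_L1_deriv u g)"

text \<open>
  The product $\tau g$ for $\tau \in W_1^{-i}[0,1]$ and $g \in W_1^{i+1}[0,1]$. It does not depend on
  the choice of $\sigma$: two choices differ by a polynomial of degree less than $i$ (almost
  everywhere), and $\int_0^1 p\,(gz)^{(i)}\,dx = 0$ for such a polynomial $p$.
\<close>

definition distr_mult :: "nat \<Rightarrow> distr \<Rightarrow> (real \<Rightarrow> complex) \<Rightarrow> distr" where
  "distr_mult i \<tau> g =
     (\<lambda>z. let \<sigma> = (SOME \<sigma>. \<sigma> \<in> L1 \<and> \<tau> \<doteq> (distr_deriv ^^ i) (distr_of \<sigma>))
      in (-1) ^ i * integral {0..1} (\<lambda>x. \<sigma> x * (L1_deriv ^^ i) (\<lambda>t. g t * z t) x))"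


subsection \<open>The differential expression of order \<open>2 * m + 1\<close>\<close>

text \<open>$i_{2k+j} = m-k-j$ for $j \in \{0,1\}$; the subtraction is exact for \<open>\<nu> \<le> 2 * m\<close>.\<close>

definition sing_order :: "nat \<Rightarrow> nat \<Rightarrow> nat" where
  "sing_order m \<nu> = m - \<nu> div 2 - \<nu> mod 2"

definition coeff_space :: "nat \<Rightarrow> (nat \<Rightarrow> distr) set" where
  "coeff_space m = {\<tau>. \<forall>\<nu><2 * m + 1. \<tau> \<nu> \<in> W1_neg (sing_order m \<nu>)}"

definition diff_expr :: "nat \<Rightarrow> (nat \<Rightarrow> distr) \<Rightarrow> (real \<Rightarrow> complex) \<Rightarrow> distr" where
  "diff_expr m \<tau> y = (\<lambda>z.
     (distr_deriv ^^ (2 * m + 1)) (distr_of y) z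
   + (\<Sum>k\<le>m. (-1) ^ k *
        (distr_deriv ^^ k)
          (distr_mult (sing_order m (2 * k)) (\<tau> (2 * k)) ((L1_deriv ^^ k) y)) z)
   + (\<Sum>k<m. (-1) ^ (k + 1) *
        ((distr_deriv ^^ (k + 1))
           (distr_mult (sing_order m (2 * k + 1)) (\<tau> (2 * k + 1)) ((L1_deriv ^^ k) y)) z
       + (distr_deriv ^^ k)
           (distr_mult (sing_order m (2 * k + 1)) (\<tau> (2 * k + 1)) ((L1_deriv ^^ (k + 1)) y)) z)))"


subsection \<open>Associated matrices\<close>

text \<open>Matrix indices run from \<open>1\<close> to \<open>2 * m + 1\<close>; entries outside this range play no role.\<close>

type_synonym matrix_fun = "nat \<Rightarrow> nat \<Rightarrow> real \<Rightarrow> complex"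

definition matrix_class :: "nat \<Rightarrow> matrix_fun set" where
  "matrix_class m = {F.
     (\<forall>k\<in>{m + 1..2 * m + 1}. \<forall>j\<in>{1..m + 1}. F k j \<in> L1) \<and>
     (\<forall>k\<in>{1..2 * m + 1}. \<forall>j\<in>{1..2 * m + 1}. k < m + 1 \<or> j > m + 1 \<longrightarrow>
        (\<forall>x\<in>{0..1}. F k j x = 0))}"

fun quasi_deriv :: "matrix_fun \<Rightarrow> (real \<Rightarrow> complex) \<Rightarrow> nat \<Rightarrow> real \<Rightarrow> complex" where
  "quasi_deriv F y 0 = y"
| "quasi_deriv F y (Suc k) = (\<lambda>x. L1_deriv (quasi_deriv F y k) x
     - (\<Sum>j\<in>{1..Suc k}. F (Suc k) j x * quasi_deriv F y (j - 1) x))"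

definition quasi_domain :: "nat \<Rightarrow> matrix_fun \<Rightarrow> (real \<Rightarrow> complex) set" where
  "quasi_domain m F = {y. \<forall>k<2 * m + 1. quasi_deriv F y k \<in> W11}"

definition associated_matrices :: "nat \<Rightarrow> (nat \<Rightarrow> distr) \<Rightarrow> matrix_fun set" where
  "associated_matrices m \<tau> = {F \<in> matrix_class m.
     \<forall>y\<in>quasi_domain m F. diff_expr m \<tau> y \<doteq> distr_of (quasi_deriv F y (2 * m + 1))}"

end

theory Submission
  imports Defs
begin

text \<open>
  For $y \in W_1^{m+1}$ let $L_F(y)$ be the distribution $y^{[n]}$, computed with distributional
  derivatives. By the lemma of du Bois-Reymond, $\mathcal D_F$ consists of the
  $y \in W_1^{m+1}$ with $L_F(y) \in L_1$. Tested against a fixed function, both $\ell_n(y)$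
  and $L_F(y)$ are sums of integrals $\int \omega_i y^{(i)}$ with $i \le m$ and
  $\omega_i \in L_1$, so they are continuous in the $C^m$ norm. On the other hand
  $\mathcal D_F$ is dense in $W_1^{m+1}$ for this norm: replacing the $L_1$ function that
  occurs in $y^{[m+1]}$ by a nearby polynomial changes $y^{(m)}$ by the solution of a Volterra
  equation with small right-hand side. Hence $\ell_n = L_F$ on all of $W_1^{m+1}$ for every
  associated $F$, and $\mathcal D_F$ depends only on $\ell_n$.
\<close>

section \<open>Integrable functions on the unit interval\<close>

text \<open>The obstacle: being associated says something only on the domain of the matrix itself,
  so for \<open>y\<close> in the domain of \<open>F\<close> the matrix \<open>G\<close> gives at
  first no information about \<open>y\<close>. The identity \<ell>_n = L_G has to be extended beyond
  the domain of \<open>G\<close> before it can be applied to \<open>y\<close>. The construction in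
  the density step comes from one formula. Write I for integration from 0 and R_k for the sum of
  f_{k,j} y^{(j-1)} over j. The recursion for the quasi-derivatives collapses to y^{[n]} = u^{(m)}
  with u = y^{(m+1)} - (sum of I^{k-m-1} R_k over k = m+1, ..., n). For a general \<open>y\<close>
  in W_1^{m+1} the function u is merely in L_1; making it a polynomial P moves \<open>y\<close> into
  the domain. For a perturbation y + I^m w this prescribes w' = P - u + (sum of I^{k-m-1} S_k),
  where S_k is the row sum of I^m w. Integrated, this is the Volterra equation for w. Its operator
  need not be small in the sup norm, because the entries of the matrix are arbitrary L_1 functions;
  an exponential weight makes it a contraction.\<close>

definition ae_eq :: "(real \<Rightarrow> complex) \<Rightarrow> (real \<Rightarrow> complex) \<Rightarrow> bool"  (infix "\<simeq>" 50) where
  "f \<simeq> g \<longleftrightarrow> (\<exists>N. negligible N \<and> (\<forall>x\<in>{0..1} - N. f x = g x))"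

lemma ae_eqI: "(\<And>x. x \<in> {0..1} \<Longrightarrow> f x = g x) \<Longrightarrow> f \<simeq> g"
  unfolding ae_eq_def by (metis DiffD1 negligible_empty)

lemma ae_eq_refl [simp]: "f \<simeq> f"
  by (rule ae_eqI) simp

lemma ae_eq_sym: "f \<simeq> g \<Longrightarrow> g \<simeq> f"
  unfolding ae_eq_def by metis

lemma ae_eq_combine:
  assumes "f \<simeq> g" "f' \<simeq> g'"
    and "\<And>x. x \<in> {0..1} \<Longrightarrow> f x = g x \<Longrightarrow> f' x = g' x \<Longrightarrow> p x = q x"
  shows "p \<simeq> q"
proof -
  obtain N N' where "negligible N" "\<forall>x\<in>{0..1} - N. f x = g x"
    "negligible N'" "\<forall>x\<in>{0..1} - N'. f' x = g' x"
    using assms unfolding ae_eq_def by metis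
  then have "negligible (N \<union> N') \<and> (\<forall>x\<in>{0..1} - (N \<union> N'). p x = q x)"
    using assms(3) by auto
  then show ?thesis unfolding ae_eq_def by blast
qed

lemma ae_eq_mono:
  assumes "f \<simeq> g" and "\<And>x. x \<in> {0..1} \<Longrightarrow> f x = g x \<Longrightarrow> p x = q x"
  shows "p \<simeq> q"
  using ae_eq_combine[OF assms(1) assms(1)] assms(2) by blast

lemma ae_eq_trans [trans]: "f \<simeq> g \<Longrightarrow> g \<simeq> h \<Longrightarrow> f \<simeq> h"
  by (rule ae_eq_combine[of f g g h]) auto

lemma ae_eq_add: "f \<simeq> g \<Longrightarrow> f' \<simeq> g' \<Longrightarrow> (\<lambda>x. f x + f' x) \<simeq> (\<lambda>x. g x + g' x)"
  by (rule ae_eq_combine[of f g f' g']) auto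

lemma ae_eq_mult: "f \<simeq> g \<Longrightarrow> f' \<simeq> g' \<Longrightarrow> (\<lambda>x. f x * f' x) \<simeq> (\<lambda>x. g x * g' x)"
  by (rule ae_eq_combine[of f g f' g']) auto

lemma ae_eq_sum: "(\<And>i. i \<in> A \<Longrightarrow> f i \<simeq> g i) \<Longrightarrow> (\<lambda>x. \<Sum>i\<in>A. f i x) \<simeq> (\<lambda>x. \<Sum>i\<in>A. g i x)"
  by (induction A rule: infinite_finite_induct) (auto intro: ae_eq_add)

lemma integral_cong_ae_eq:
  assumes "f \<simeq> g" shows "integral {0..1} f = integral {0..1} g"
proof -
  obtain N where N: "negligible N" "\<forall>x\<in>{0..1} - N. f x = g x"
    using assms unfolding ae_eq_def by metis
  then show ?thesis by (intro integral_spike[OF N(1)]) auto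
qed

lemma L1_cong_ae_eq:
  assumes "f \<simeq> g" "f \<in> L1" shows "g \<in> L1"
proof -
  obtain N where N: "negligible N" "\<forall>x\<in>{0..1} - N. f x = g x"
    using assms unfolding ae_eq_def by metis
  then show ?thesis
    using absolutely_integrable_spike[where f=f and g=g and T="{0..1}", OF _ N(1)] assms(2)
    by (auto simp: L1_def)
qed

lemma distr_of_cong: "f \<simeq> g \<Longrightarrow> distr_of f = distr_of g"
  unfolding distr_of_def by (intro ext integral_cong_ae_eq ae_eq_mult) auto

lemma L1_measurable: "f \<in> L1 \<Longrightarrow> f \<in> borel_measurable (lebesgue_on {0..1})"
  unfolding L1_def by (auto intro: absolutely_integrable_imp_borel_measurable)

lemma L1_integrable: "f \<in> L1 \<Longrightarrow> f integrable_on {0..1}"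
  unfolding L1_def using absolutely_integrable_on_def by blast

lemma L1_norm_integrable: "f \<in> L1 \<Longrightarrow> (\<lambda>x. norm (f x)) integrable_on {0..1}"
  unfolding L1_def using absolutely_integrable_on_def by blast

lemma L1_add: "f \<in> L1 \<Longrightarrow> g \<in> L1 \<Longrightarrow> (\<lambda>x. f x + g x) \<in> L1"
  unfolding L1_def by (simp add: set_integral_add(1))

lemma L1_diff: "f \<in> L1 \<Longrightarrow> g \<in> L1 \<Longrightarrow> (\<lambda>x. f x - g x) \<in> L1"
  unfolding L1_def by (simp add: set_integral_diff(1))

lemma L1_sum: "(\<And>i. i \<in> A \<Longrightarrow> f i \<in> L1) \<Longrightarrow> (\<lambda>x. \<Sum>i\<in>A. f i x) \<in> L1"
  by (induction A rule: infinite_finite_induct) (auto intro: L1_add simp: L1_def)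

lemma L1_cmult: "f \<in> L1 \<Longrightarrow> (\<lambda>x. c * f x) \<in> L1"
  unfolding L1_def by simp

lemma L1_continuous: "continuous_on {0..1} f \<Longrightarrow> f \<in> L1"
  unfolding L1_def by (simp add: absolutely_integrable_continuous_real)

lemma L1_mult_measurable:
  assumes "f \<in> L1" "g \<in> borel_measurable (lebesgue_on {0..1})" "bounded (g ` {0..1})"
  shows "(\<lambda>x. f x * g x) \<in> L1"
proof -
  have "bilinear (\<lambda>x y::complex. x * y)"
    using bilinear_times by blast
  from absolutely_integrable_bounded_measurable_product[OF this assms(2) _ assms(3), of f]
  show ?thesis using assms(1) by (simp add: L1_def mult.commute)
qed

lemma L1_mult_continuous:
  assumes "f \<in> L1" "continuous_on {0..1} g"
  shows "(\<lambda>x. f x * g x) \<in> L1"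
proof (rule L1_mult_measurable[OF assms(1)])
  show "g \<in> borel_measurable (lebesgue_on {0..1})"
    using L1_continuous[OF assms(2)] by (rule L1_measurable)
  show "bounded (g ` {0..1})"
    using assms(2) by (simp add: compact_continuous_image compact_imp_bounded)
qed

section \<open>Dominated convergence and density of polynomials in L_1\<close>

lemma dominated_convergence_ae:
  fixes f :: "nat \<Rightarrow> real \<Rightarrow> complex"
  assumes f: "\<And>k. f k integrable_on {0..1}" and h: "h integrable_on {0..1}"
    and le: "\<And>k x. x \<in> {0..1} \<Longrightarrow> norm (f k x) \<le> h x"
    and N: "negligible N" and conv: "\<And>x. x \<in> {0..1} - N \<Longrightarrow> (\<lambda>k. f k x) \<longlonglongrightarrow> g x"
  shows "(\<lambda>k. integral {0..1} (f k)) \<longlonglongrightarrow> integral {0..1} g"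
proof -
  \<comment> \<open>Zeroing on the null set \<open>N\<close> turns convergence almost everywhere
    into convergence everywhere without changing any integral.\<close>
  let ?z = "\<lambda>u x. if x \<in> N then 0 else u x :: complex"
  have eq: "integral {0..1} (?z u) = integral {0..1} u" for u
    by (rule integral_spike[OF N]) auto
  have h0: "0 \<le> h x" if "x \<in> {0..1}" for x
    using le[OF that, of 0] norm_ge_zero order_trans by blast
  have "(\<lambda>k. integral {0..1} (?z (f k))) \<longlonglongrightarrow> integral {0..1} (?z g)"
  proof (rule dominated_convergence(2)[OF _ h])
    show "(?z (f k)) integrable_on {0..1}" for k
      by (rule integrable_spike[OF f[of k] N]) auto
    show "norm (?z (f k) x) \<le> h x" if "x \<in> {0..1}" for k x
      using le[OF that] h0[OF that] by auto
    show "(\<lambda>k. ?z (f k) x) \<longlonglongrightarrow> ?z g x" if "x \<in> {0..1}" for x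
      using conv[of x] that by auto
  qed
  then show ?thesis unfolding eq .
qed

lemma dominated_convergence_norm_ae:
  fixes f :: "nat \<Rightarrow> real \<Rightarrow> complex"
  assumes f: "\<And>k. f k \<in> L1" and g: "g \<in> L1" and h: "h integrable_on {0..1}"
    and le: "\<And>k x. x \<in> {0..1} \<Longrightarrow> norm (f k x) \<le> h x"
    and N: "negligible N" and conv: "\<And>x. x \<in> {0..1} - N \<Longrightarrow> (\<lambda>k. f k x) \<longlonglongrightarrow> g x"
  shows "(\<lambda>k. integral {0..1} (\<lambda>x. norm (f k x - g x))) \<longlonglongrightarrow> 0"
proof -
  let ?d = "\<lambda>k x. norm (f k x - g x)"
  have di: "?d k integrable_on {0..1}" for k
    using L1_norm_integrable[OF L1_diff[OF f g]] .
  \<comment> \<open>The norms are real, while \<open>dominated_convergence_ae\<close> concerns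
    complex-valued functions; \<open>complex_of_real\<close> bridges the two.\<close>
  have "(\<lambda>k. integral {0..1} (\<lambda>x. complex_of_real (?d k x))) \<longlonglongrightarrow> integral {0..1::real} (\<lambda>x. 0)"
  proof (rule dominated_convergence_ae[where h="\<lambda>x. h x + norm (g x)" and N=N])
    show "(\<lambda>x. complex_of_real (?d k x)) integrable_on {0..1}" for k
      using integrable_linear[OF di[of k] bounded_linear_of_real] by (simp add: o_def)
    show "(\<lambda>x. h x + norm (g x)) integrable_on {0..1}"
      using h L1_norm_integrable[OF g] by (rule integrable_add)
    show "norm (complex_of_real (?d k x)) \<le> h x + norm (g x)" if "x \<in> {0..1}" for k x
      using le[OF that, of k] norm_triangle_ineq4[of "f k x" "g x"] by simp
    show "negligible N" by (rule N)
    show "(\<lambda>k. complex_of_real (?d k x)) \<longlonglongrightarrow> 0" if "x \<in> {0..1} - N" for x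
    proof -
      have "(\<lambda>k. norm (f k x - g x)) \<longlonglongrightarrow> norm (g x - g x)"
        using conv[OF that] by (intro tendsto_intros)
      from tendsto_of_real[OF this, where 'a=complex] show ?thesis by simp
    qed
  qed
  moreover have "integral {0..1} (\<lambda>x. complex_of_real (?d k x)) = of_real (integral {0..1} (?d k))" for k
    using integral_linear[OF di[of k] bounded_linear_of_real[where 'a=complex]] by (simp add: o_def)
  ultimately have "(\<lambda>k. complex_of_real (integral {0..1} (?d k))) \<longlonglongrightarrow> complex_of_real 0"
    by simp
  then show ?thesis using tendsto_of_real_iff by blast
qed

lemma continuous_polynomial_function:
  fixes p :: "real \<Rightarrow> complex"
  shows "polynomial_function p \<Longrightarrow> continuous_on S p"
  using continuous_on_polymonial_function by blast

text \<open>For \<open>r > 0\<close> this is the radial retraction of the plane onto the closed disc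
  of radius \<open>r\<close>. The \<open>max\<close> makes it one formula, so that continuity is
  immediate.\<close>

definition clamp_norm :: "real \<Rightarrow> complex \<Rightarrow> complex" where
  "clamp_norm r w = (r / max r (norm w)) *\<^sub>R w"

lemma continuous_on_clamp_norm: "r > 0 \<Longrightarrow> continuous_on S (clamp_norm r)"
  unfolding clamp_norm_def by (intro continuous_intros) auto

lemma norm_clamp_norm: "r > 0 \<Longrightarrow> norm (clamp_norm r w) \<le> r"
  unfolding clamp_norm_def
  by (simp add: max_def mult_left_le divide_simps mult.commute)

lemma norm_clamp_norm_le: "r > 0 \<Longrightarrow> norm (clamp_norm r w) \<le> norm w"
  unfolding clamp_norm_def
  by (auto simp: max_def divide_simps mult_left_mono)

lemma clamp_norm_id: "norm w \<le> r \<Longrightarrow> r > 0 \<Longrightarrow> clamp_norm r w = w"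
  unfolding clamp_norm_def by (simp add: max_def)

text \<open>A measurable function is almost everywhere a limit of continuous functions. Clamping
  keeps these bounded by \<open>r\<close>, and a uniform polynomial approximation with error below
  1/(k+1) adds at most 1 to the bound. The limit is the clamped \<open>f\<close> because clamping is
  continuous.\<close>

lemma bounded_polynomial_approx:
  fixes f :: "real \<Rightarrow> complex"
  assumes f: "f \<in> borel_measurable (lebesgue_on {0..1})" and r: "r > 0"
  obtains N p where "negligible N" "\<And>k::nat. polynomial_function (p k)"
    "\<And>k x. x \<in> {0..1} \<Longrightarrow> norm (p k x) \<le> r + 1"
    "\<And>x. x \<in> {0..1} - N \<Longrightarrow> (\<lambda>k. p k x) \<longlonglongrightarrow> clamp_norm r (f x)"
proof -
  have "f measurable_on {0..1}"
    using measurable_on_iff_borel_measurable[of "{0..1::real}" f] f by fastforce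
  then obtain N g where N: "negligible N" and g: "\<And>n. continuous_on UNIV (g n)"
    and lim: "\<And>x. x \<notin> N \<Longrightarrow> (\<lambda>n. g n x) \<longlonglongrightarrow> (if x \<in> {0..1} then f x else 0)"
    unfolding measurable_on_def by metis
  have "\<exists>p. polynomial_function p \<and> (\<forall>x\<in>{0..1}. norm (clamp_norm r (g k x) - p x) < 1 / Suc k)" for k
  proof (rule Stone_Weierstrass_polynomial_function)
    show "continuous_on {0..1} (\<lambda>x. clamp_norm r (g k x))"
      by (rule continuous_on_compose2[OF continuous_on_clamp_norm[OF r, of UNIV]])
        (use g[of k] continuous_on_subset in auto)
  qed auto
  then obtain p where p: "\<And>k. polynomial_function (p k)"
    "\<And>k x. x \<in> {0..1} \<Longrightarrow> norm (clamp_norm r (g k x) - p k x) < 1 / Suc k"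
    by metis
  have le: "1 / real (Suc k) \<le> 1" for k by simp
  show thesis
  proof (rule that[OF N p(1)])
    show "norm (p k x) \<le> r + 1" if "x \<in> {0..1}" for k x
      using less_le_trans[OF p(2)[OF that, of k] le[of k]] norm_clamp_norm[OF r, of "g k x"]
        norm_triangle_ineq4[of "clamp_norm r (g k x)" "clamp_norm r (g k x) - p k x"] by (simp del: of_nat_Suc)
    show "(\<lambda>k. p k x) \<longlonglongrightarrow> clamp_norm r (f x)" if x: "x \<in> {0..1} - N" for x
    proof -
      have "(\<lambda>k. g k x) \<longlonglongrightarrow> f x" using lim[of x] x by simp
      then have 1: "(\<lambda>k. clamp_norm r (g k x)) \<longlonglongrightarrow> clamp_norm r (f x)"
        using continuous_on_tendsto_compose[OF continuous_on_clamp_norm[OF r, of UNIV]] by auto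
      have "(\<lambda>k. clamp_norm r (g k x) - p k x) \<longlonglongrightarrow> 0"
        by (rule Lim_null_comparison[OF _ LIMSEQ_Suc[OF lim_1_over_n]])
           (use p(2)[of x] x in \<open>auto intro!: always_eventually less_imp_le\<close>)
      from tendsto_diff[OF 1 this] show ?thesis by simp
    qed
  qed
qed

text \<open>Dominated convergence is used twice: \<open>f\<close> is approximated by its
  truncations, dominated by |f|, and a fixed truncation at level \<open>r\<close> by polynomials,
  dominated by the constant r + 1.\<close>

lemma L1_polynomial_approx:
  assumes f: "f \<in> L1" and e: "e > 0"
  obtains p where "polynomial_function p" "integral {0..1} (\<lambda>x. norm (p x - f x)) < e"
proof -
  have fm: "f \<in> borel_measurable (lebesgue_on {0..1})" using L1_measurable[OF f] .
  have clL1: "(\<lambda>x. clamp_norm r (f x)) \<in> L1" if "r > 0" for r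
  proof -
    have "(\<lambda>x. clamp_norm r (f x)) \<in> borel_measurable (lebesgue_on {0..1})"
      by (rule borel_measurable_continuous_on[OF continuous_on_clamp_norm[OF that] fm])
    then show ?thesis unfolding L1_def
      using measurable_bounded_by_integrable_imp_absolutely_integrable[OF _ _ L1_norm_integrable[OF f]]
        norm_clamp_norm_le[OF that] by auto
  qed
  have "(\<lambda>k. integral {0..1} (\<lambda>x. norm (clamp_norm (real (Suc k)) (f x) - f x))) \<longlonglongrightarrow> 0"
  proof (rule dominated_convergence_norm_ae[OF _ f L1_norm_integrable[OF f] _ negligible_empty])
    show "(\<lambda>k. clamp_norm (real (Suc k)) (f x)) \<longlonglongrightarrow> f x" for x
    proof (rule tendsto_eventually)
      obtain n where "norm (f x) \<le> real n" using real_arch_simple by blast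
      then show "\<forall>\<^sub>F k in sequentially. clamp_norm (real (Suc k)) (f x) = f x"
        by (intro eventually_sequentiallyI[of n] clamp_norm_id) auto
    qed
  qed (auto intro!: clL1 norm_clamp_norm_le simp del: of_nat_Suc)
  then have "\<forall>\<^sub>F k in sequentially. integral {0..1} (\<lambda>x. norm (clamp_norm (real (Suc k)) (f x) - f x)) < e/2"
    by (rule order_tendstoD(2)) (use e in simp)
  then obtain k where k: "integral {0..1} (\<lambda>x. norm (clamp_norm (real (Suc k)) (f x) - f x)) < e/2"
    using eventually_happens'[OF sequentially_bot] by blast
  define r where "r = real (Suc k)"
  have r: "r > 0" by (simp add: r_def)
  obtain N p where N: "negligible N" and p: "\<And>k::nat. polynomial_function (p k)"
    "\<And>k x. x \<in> {0..1} \<Longrightarrow> norm (p k x) \<le> r + 1"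
    "\<And>x. x \<in> {0..1} - N \<Longrightarrow> (\<lambda>k. p k x) \<longlonglongrightarrow> clamp_norm r (f x)"
    using bounded_polynomial_approx[OF fm r] by metis
  have pL: "p k \<in> L1" for k by (intro L1_continuous continuous_polynomial_function p(1))
  have "(\<lambda>k. integral {0..1} (\<lambda>x. norm (p k x - clamp_norm r (f x)))) \<longlonglongrightarrow> 0"
    by (rule dominated_convergence_norm_ae[OF pL clL1[OF r] _ p(2) N p(3)]) auto
  then have "\<forall>\<^sub>F k in sequentially. integral {0..1} (\<lambda>x. norm (p k x - clamp_norm r (f x))) < e/2"
    by (rule order_tendstoD(2)) (use e in simp)
  then obtain j where j: "integral {0..1} (\<lambda>x. norm (p j x - clamp_norm r (f x))) < e/2"
    using eventually_happens'[OF sequentially_bot] by blast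
  have i: "(\<lambda>x. norm (p j x - clamp_norm r (f x))) integrable_on {0..1}"
    "(\<lambda>x. norm (clamp_norm r (f x) - f x)) integrable_on {0..1}"
    "(\<lambda>x. norm (p j x - f x)) integrable_on {0..1}"
    by (intro L1_norm_integrable L1_diff clL1 pL f r)+
  have "integral {0..1} (\<lambda>x. norm (p j x - f x)) \<le>
      integral {0..1} (\<lambda>x. norm (p j x - clamp_norm r (f x)) + norm (clamp_norm r (f x) - f x))"
    by (rule integral_le[OF i(3) integrable_add[OF i(1,2)]]) (metis norm_diff_triangle_le order_refl)
  also have "\<dots> < e" using j k integral_add[OF i(1,2)] unfolding r_def by simp
  finally show thesis using that p(1) by blast
qed

section \<open>Smooth functions and test functions\<close>

definition smooth :: "(real \<Rightarrow> complex) \<Rightarrow> bool" where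
  "smooth f \<longleftrightarrow> (\<forall>k x. ((cderiv ^^ k) f) differentiable (at x))"

lemma smooth_cderiv: "smooth f \<Longrightarrow> smooth (cderiv f)"
  unfolding smooth_def by (metis funpow_Suc_right o_apply)

lemma smooth_has_vector_derivative: "smooth f \<Longrightarrow> (f has_vector_derivative cderiv f x) (at x)"
  unfolding smooth_def cderiv_def by (metis funpow_0 vector_derivative_works)

lemma cderiv_eq: "(\<And>x. (f has_vector_derivative g x) (at x)) \<Longrightarrow> cderiv f = g"
  unfolding cderiv_def using vector_derivative_at by blast

text \<open>Membership in a class closed under differentiation suffices, so formulas for the
  derivative of order \<open>k\<close> are never written down.\<close>

lemma smooth_coinduct:
  assumes "P f" and step: "\<And>f. P f \<Longrightarrow> \<exists>g. P g \<and> (\<forall>x. (f has_vector_derivative g x) (at x))"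
  shows "smooth f"
proof -
  have "P ((cderiv ^^ k) f)" for k
  proof (induction k)
    case (Suc k)
    then show ?case using step[OF Suc] cderiv_eq by auto
  qed (simp add: assms(1))
  then show ?thesis unfolding smooth_def using step differentiableI_vector by blast
qed

lemma smooth_continuous_on: "smooth f \<Longrightarrow> continuous_on S f"
  using smooth_has_vector_derivative[THEN has_vector_derivative_continuous]
  by (simp add: continuous_at_imp_continuous_on)

text \<open>The derivative of a product is a sum of two products, so products alone are not closed
  under differentiation; sums of products are.\<close>

inductive_set prod_sums :: "(real \<Rightarrow> complex) set" where
  prod: "smooth f \<Longrightarrow> smooth g \<Longrightarrow> (\<lambda>x. f x * g x) \<in> prod_sums"
| add: "f \<in> prod_sums \<Longrightarrow> g \<in> prod_sums \<Longrightarrow> (\<lambda>x. f x + g x) \<in> prod_sums"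

lemma smooth_prod_sums: "f \<in> prod_sums \<Longrightarrow> smooth f"
proof (rule smooth_coinduct[where P="\<lambda>f. f \<in> prod_sums"])
  fix f assume "f \<in> prod_sums"
  then show "\<exists>g. g \<in> prod_sums \<and> (\<forall>x. (f has_vector_derivative g x) (at x))"
  proof induction
    case (prod f g)
    have "(\<lambda>x. f x * cderiv g x + cderiv f x * g x) \<in> prod_sums"
      by (intro prod_sums.intros smooth_cderiv prod)
    moreover have "((\<lambda>x. f x * g x) has_vector_derivative f x * cderiv g x + cderiv f x * g x) (at x)" for x
      by (intro has_vector_derivative_mult smooth_has_vector_derivative prod)
    ultimately show ?case by blast
  next
    case (add f g)
    then obtain f' g' where d: "f' \<in> prod_sums" "\<And>x. (f has_vector_derivative f' x) (at x)"
      "g' \<in> prod_sums" "\<And>x. (g has_vector_derivative g' x) (at x)" by blast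
    show ?case
      by (rule exI[of _ "\<lambda>x. f' x + g' x"]) (simp add: d prod_sums.add has_vector_derivative_add)
  qed
qed

lemma polynomial_function_smooth:
  fixes p :: "real \<Rightarrow> complex"
  shows "polynomial_function p \<Longrightarrow> smooth p"
  by (erule smooth_coinduct[where P=polynomial_function])
    (metis has_vector_derivative_polynomial_function)

lemma smooth_const: "smooth (\<lambda>x. c)"
  by (simp add: polynomial_function_smooth)

lemma smooth_mult: "smooth f \<Longrightarrow> smooth g \<Longrightarrow> smooth (\<lambda>x. f x * g x)"
  by (rule smooth_prod_sums) (rule prod_sums.prod)

lemma smooth_add: "smooth f \<Longrightarrow> smooth g \<Longrightarrow> smooth (\<lambda>x. f x + g x)"
  using prod_sums.add[OF prod_sums.prod[of f "\<lambda>x. 1"] prod_sums.prod[of g "\<lambda>x. 1"]]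
  by (auto simp: smooth_const intro: smooth_prod_sums)

lemma smooth_affine:
  assumes "smooth f" shows "smooth (\<lambda>x. f (a * x + b))"
\<comment> \<open>The factor \<open>c\<close> absorbs the powers of \<open>a\<close> that the chain
  rule produces.\<close>
proof (rule smooth_coinduct[where P="\<lambda>h. \<exists>c f. smooth f \<and> h = (\<lambda>x. c * f (a * x + b))"])
  show "\<exists>c f'. smooth f' \<and> (\<lambda>x. f (a * x + b)) = (\<lambda>x. c * f' (a * x + b))"
    by (rule exI[of _ 1], rule exI[of _ f]) (use assms in simp)
next
  fix h assume "\<exists>c f. smooth f \<and> h = (\<lambda>x. c * f (a * x + b))"
  then obtain c f where f: "smooth f" and h: "h = (\<lambda>x. c * f (a * x + b))" by blast
  have "(h has_vector_derivative (c * a) * cderiv f (a * x + b)) (at x)" for x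
  proof -
    have "((\<lambda>x. a * x + b) has_vector_derivative a) (at x)"
      by (auto intro!: derivative_eq_intros simp: has_real_derivative_iff_has_vector_derivative[symmetric])
    from vector_diff_chain_at[OF this smooth_has_vector_derivative[OF f]]
    have "((\<lambda>x. f (a * x + b)) has_vector_derivative a *\<^sub>R cderiv f (a * x + b)) (at x)"
      by (simp add: o_def)
    from has_vector_derivative_mult_right[OF this, of c] show ?thesis
      by (simp add: h scaleR_conv_of_real mult_ac)
  qed
  then show "\<exists>g. (\<exists>c f. smooth f \<and> g = (\<lambda>x. c * f (a * x + b))) \<and> (\<forall>x. (h has_vector_derivative g x) (at x))"
    using smooth_cderiv[OF f] by blast
qed

section \<open>Test functions and bump functions\<close>

lemma test_funs_iff:
  "z \<in> test_funs \<longleftrightarrow> smooth z \<and> (\<exists>a b. 0 < a \<and> a < b \<and> b < 1 \<and> (\<forall>x. x \<notin> {a..b} \<longrightarrow> z x = 0))"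
proof
  assume z: "z \<in> test_funs"
  then obtain K where K: "compact K" "K \<subseteq> {0<..<1}" "\<forall>x. x \<notin> K \<longrightarrow> z x = 0"
    unfolding test_funs_def by blast
  have "\<exists>a b. 0 < a \<and> a < b \<and> b < 1 \<and> K \<subseteq> {a..b}"
  proof (cases "K = {}")
    case True
    then show ?thesis by (intro exI[of _ "1/3"] exI[of _ "1/2"]) auto
  next
    case False
    obtain s t where st: "s \<in> K" "t \<in> K" "\<And>x. x \<in> K \<Longrightarrow> s \<le> x \<and> x \<le> t"
      using compact_attains_inf[OF K(1) False] compact_attains_sup[OF K(1) False] by metis
    then have "0 < s" "s \<le> t" "t < 1" using K(2) by auto
    \<comment> \<open>The left end \<open>s/2\<close> instead of \<open>s\<close> keeps the interval
      nondegenerate when \<open>K\<close> is a single point.\<close>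
    then show ?thesis using st(3)
      by (intro exI[of _ "s/2"] exI[of _ "t"]) fastforce
  qed
  then show "smooth z \<and> (\<exists>a b. 0 < a \<and> a < b \<and> b < 1 \<and> (\<forall>x. x \<notin> {a..b} \<longrightarrow> z x = 0))"
    using z K(3) unfolding test_funs_def smooth_def by blast
next
  assume "smooth z \<and> (\<exists>a b. 0 < a \<and> a < b \<and> b < 1 \<and> (\<forall>x. x \<notin> {a..b} \<longrightarrow> z x = 0))"
  then obtain a b where "smooth z" "0 < a" "a < b" "b < 1" "\<forall>x. x \<notin> {a..b} \<longrightarrow> z x = 0" by blast
  then show "z \<in> test_funs" unfolding test_funs_def smooth_def
    by (auto intro!: exI[of _ "{a..b}"])
qed

lemma test_funs_smooth: "z \<in> test_funs \<Longrightarrow> smooth z"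
  by (simp add: test_funs_iff)

lemma test_funs_continuous_on: "z \<in> test_funs \<Longrightarrow> continuous_on S z"
  by (simp add: test_funs_smooth smooth_continuous_on)

lemma test_funs_cderiv: 
  assumes "z \<in> test_funs" shows "cderiv z \<in> test_funs"
proof -
  obtain a b where ab: "0 < a" "a < b" "b < 1" "\<forall>x. x \<notin> {a..b} \<longrightarrow> z x = 0" and s: "smooth z"
    using assms test_funs_iff by metis
  have "cderiv z x = 0" if "x \<notin> {a..b}" for x
  proof -
    have "open (- {a..b})" by (intro open_Compl closed_atLeastAtMost)
    moreover have "x \<in> - {a..b}" using that by simp
    moreover have "((\<lambda>x. 0::complex) has_vector_derivative 0) (at x)" by simp
    ultimately have "(z has_vector_derivative 0) (at x)"
      using has_vector_derivative_transform_within_open[of "\<lambda>x. 0" 0 x "- {a..b}" z] ab(4) by auto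
    then show ?thesis unfolding cderiv_def by (rule vector_derivative_at)
  qed
  then show ?thesis using ab s smooth_cderiv test_funs_iff by metis
qed

lemma test_funs_funpow_cderiv: "z \<in> test_funs \<Longrightarrow> (cderiv ^^ k) z \<in> test_funs"
  by (induction k) (auto intro: test_funs_cderiv)

lemma test_funs_mult: "z \<in> test_funs \<Longrightarrow> smooth f \<Longrightarrow> (\<lambda>x. f x * z x) \<in> test_funs"
  unfolding test_funs_iff using smooth_mult by (metis mult_zero_right)

lemma test_funs_add: 
  assumes "z \<in> test_funs" "w \<in> test_funs" shows "(\<lambda>x. z x + w x) \<in> test_funs"
proof -
  obtain a b a' b' where "0 < a" "a < b" "b < 1" "\<forall>x. x \<notin> {a..b} \<longrightarrow> z x = 0"
     "0 < a'" "a' < b'" "b' < 1" "\<forall>x. x \<notin> {a'..b'} \<longrightarrow> w x = 0"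
    using assms test_funs_iff by metis
  moreover from this have "z x + w x = 0" if "x \<notin> {min a a'..max b b'}" for x
  proof -
    have "x \<notin> {a..b}" "x \<notin> {a'..b'}" using that by auto
    then show ?thesis using calculation by simp
  qed
  ultimately have "0 < min a a' \<and> min a a' < max b b' \<and> max b b' < 1 \<and>
    (\<forall>x. x \<notin> {min a a'..max b b'} \<longrightarrow> z x + w x = 0)" by auto
  then show ?thesis using assms smooth_add unfolding test_funs_iff by blast
qed

lemma test_funs_cmult: "z \<in> test_funs \<Longrightarrow> (\<lambda>x. c * z x) \<in> test_funs"
  by (rule test_funs_mult[OF _ smooth_const])

lemma test_funs_zero: "(\<lambda>x. 0) \<in> test_funs"
  unfolding test_funs_iff
  by (rule conjI[OF smooth_const], rule exI[of _ "1/3"], rule exI[of _ "1/2"]) simp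

lemma cderiv_mult: "smooth f \<Longrightarrow> smooth g \<Longrightarrow> cderiv (\<lambda>x. f x * g x) = (\<lambda>x. f x * cderiv g x + cderiv f x * g x)"
  by (intro cderiv_eq has_vector_derivative_mult smooth_has_vector_derivative)

lemma cderiv_add: "smooth f \<Longrightarrow> smooth g \<Longrightarrow> cderiv (\<lambda>x. f x + g x) = (\<lambda>x. cderiv f x + cderiv g x)"
  by (intro cderiv_eq has_vector_derivative_add smooth_has_vector_derivative)

lemma cderiv_cmult: "smooth f \<Longrightarrow> cderiv (\<lambda>x. c * f x) = (\<lambda>x. c * cderiv f x)"
  by (intro cderiv_eq has_vector_derivative_mult_right smooth_has_vector_derivative)

lemma integral_cderiv_test_funs:
  assumes "z \<in> test_funs" shows "integral {0..1} (cderiv z) = 0"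
proof -
  have "(cderiv z has_integral z 1 - z 0) {0..1}"
    using smooth_has_vector_derivative[OF test_funs_smooth[OF assms]]
    by (intro fundamental_theorem_of_calculus) (auto intro: has_vector_derivative_at_within)
  moreover have "z 1 = 0" "z 0 = 0" using assms unfolding test_funs_iff by force+
  ultimately show ?thesis by (simp add: integral_unique)
qed

text \<open>The functions $p(1/x) e^{-1/x}$ on the positive half-line are closed under differentiation.\<close>

definition flat :: "real poly \<Rightarrow> real \<Rightarrow> complex" where
  "flat p x = (if x > 0 then complex_of_real (poly p (1 / x) * exp (- 1 / x)) else 0)"

lemma poly_exp_tendsto: "((\<lambda>s. poly p s * exp (- s)) \<longlongrightarrow> (0::real)) at_top"
proof -
  have "((\<lambda>s. \<Sum>i\<le>degree p. coeff p i * (s ^ i / exp s)) \<longlongrightarrow> (\<Sum>i\<le>degree p. coeff p i * 0)) at_top"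
    by (intro tendsto_sum tendsto_mult tendsto_const tendsto_power_div_exp_0)
  then show ?thesis
    by (simp add: poly_altdef exp_minus divide_inverse sum_distrib_left mult_ac)
qed

lemma flat_tendsto_0: "((\<lambda>x. poly p (1 / x) * exp (- 1 / x)) \<longlongrightarrow> (0::real)) (at_right 0)"
  using filterlim_compose[OF poly_exp_tendsto[of p] filterlim_inverse_at_top_right]
  by (simp add: divide_inverse)

lemma smooth_flat: "smooth (flat p)"
proof (rule smooth_coinduct[where P="\<lambda>h. \<exists>p. h = flat p"])
  fix h assume "\<exists>p. h = flat p"
  then obtain p where h: "h = flat p" by blast
  \<comment> \<open>With s = 1/x one has ds/dx = -s^2, so p(s) e^{-s} has the derivative s^2 (p(s) -
    p'(s)) e^{-s}.\<close>
  define q where "q = [:0, 0, 1:] * (p - pderiv p)"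
  have "(flat p has_vector_derivative flat q x) (at x)" for x
  proof -
    consider "x > 0" | "x < 0" | "x = 0" by linarith
    then show ?thesis
    proof cases
      case 1
      have i: "((\<lambda>x. 1 / x) has_real_derivative - 1 / x\<^sup>2) (at x)"
        using 1 by (auto intro!: derivative_eq_intros simp: power2_eq_square)
      have "((\<lambda>x. poly p (1 / x)) has_real_derivative poly (pderiv p) (1 / x) * (- 1 / x\<^sup>2)) (at x)"
        by (rule DERIV_chain2[OF poly_DERIV i])
      moreover have "((\<lambda>x. exp (- (1 / x))) has_real_derivative exp (- (1 / x)) * (- (- 1 / x\<^sup>2))) (at x)"
        by (rule DERIV_chain2[OF DERIV_exp DERIV_minus[OF i]])
      ultimately have "((\<lambda>x. poly p (1 / x) * exp (- (1 / x))) has_real_derivative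
          poly (pderiv p) (1 / x) * (- 1 / x\<^sup>2) * exp (- (1 / x)) + exp (- (1 / x)) * (- (- 1 / x\<^sup>2)) * poly p (1 / x)) (at x)"
        by (rule DERIV_mult)
      moreover have "poly (pderiv p) (1 / x) * (- 1 / x\<^sup>2) * exp (- (1 / x)) + exp (- (1 / x)) * (- (- 1 / x\<^sup>2)) * poly p (1 / x)
          = poly q (1 / x) * exp (- (1 / x))"
        using 1 unfolding q_def by (simp add: field_simps power2_eq_square)
      ultimately have "((\<lambda>x. complex_of_real (poly p (1 / x) * exp (- (1 / x)))) has_vector_derivative
          complex_of_real (poly q (1 / x) * exp (- (1 / x)))) (at x)"
        using has_vector_derivative_of_real has_real_derivative_iff_has_vector_derivative by metis
      then show ?thesis
        using has_vector_derivative_transform_within_open[of _ _ x "{0<..}" "flat p"] 1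
        by (auto simp: flat_def)
    next
      case 2
      have "((\<lambda>x. 0::complex) has_vector_derivative 0) (at x)" by simp
      then show ?thesis
        using has_vector_derivative_transform_within_open[of "\<lambda>x. 0" 0 x "{..<0}" "flat p"] 2
        by (auto simp: flat_def)
    next
      case 3
      \<comment> \<open>From the left the quotient is 0. From the right, dividing by
        \<open>y\<close> multiplies the polynomial in 1/y by its variable, so the quotient is again
        of the kind covered by \<open>flat_tendsto_0\<close>.\<close>
      have "((\<lambda>y. norm (flat p y) / norm y) \<longlongrightarrow> 0) (at 0)"
      proof (rule filterlim_split_at)
        have "\<forall>\<^sub>F y in at_left 0. norm (flat p y) / norm y = 0"
          by (intro eventually_at_leftI[of "-1"]) (auto simp: flat_def)
        then show "((\<lambda>y. norm (flat p y) / norm y) \<longlongrightarrow> 0) (at_left 0)"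
          by (rule tendsto_eventually)
        have "\<forall>\<^sub>F y in at_right (0::real). \<bar>poly ([:0, 1:] * p) (1 / y) * exp (- 1 / y)\<bar> = norm (flat p y) / norm y"
          by (intro eventually_at_rightI[of _ 1]) (auto simp: flat_def abs_mult norm_mult field_simps)
        then show "((\<lambda>y. norm (flat p y) / norm y) \<longlongrightarrow> 0) (at_right 0)"
          using tendsto_rabs_zero[OF flat_tendsto_0[of "[:0, 1:] * p"]] by (rule Lim_transform_eventually[rotated])
      qed
      then have "(flat p has_vector_derivative 0) (at 0)"
        unfolding has_vector_derivative_def has_derivative_iff_norm
        by (simp add: flat_def[of _ 0] bounded_linear_zero)
      then show ?thesis using 3 by (simp add: flat_def[of q])
    qed
  qed
  then show "\<exists>g. (\<exists>p. g = flat p) \<and> (\<forall>x. (h has_vector_derivative g x) (at x))"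
    using h by blast
qed blast

lemma norm_flat_one: "norm (flat 1 y) \<le> 1"
  unfolding flat_def by auto

text \<open>\<open>flat 1\<close> is 0 up to the origin and then increases to 1 at infinity. Hence
  these functions are bounded by 1, vanish outside [1/(k+3), 1 - 1/(k+3)] and tend to 1 pointwise on
  (0,1). The shift by 3 keeps that interval nondegenerate.\<close>

definition cutoff :: "nat \<Rightarrow> real \<Rightarrow> complex" where
  "cutoff k x = flat 1 (real (k + 3) * x - 1) * flat 1 (real (k + 3) * (1 - x) - 1)"

lemma smooth_cutoff: "smooth (cutoff k)"
proof -
  have "smooth (\<lambda>x. flat 1 (real (k + 3) * x + - 1) * flat 1 (- real (k + 3) * x + (real (k + 3) - 1)))"
    by (intro smooth_mult smooth_affine smooth_flat)
  moreover have "cutoff k = (\<lambda>x. flat 1 (real (k + 3) * x + - 1) * flat 1 (- real (k + 3) * x + (real (k + 3) - 1)))"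
    unfolding cutoff_def by (intro ext) (simp add: algebra_simps)
  ultimately show ?thesis by simp
qed

lemma norm_cutoff: "norm (cutoff k x) \<le> 1"
  unfolding cutoff_def norm_mult using mult_mono[OF norm_flat_one norm_flat_one] by fastforce

lemma cutoff_test_funs: "cutoff k \<in> test_funs"
proof -
  let ?n = "real (k + 3)"
  have "cutoff k x = 0" if "x \<notin> {1 / ?n..1 - 1 / ?n}" for x
  proof -
    have "?n * x - 1 \<le> 0 \<or> ?n * (1 - x) - 1 \<le> 0"
      using that by (auto simp: field_simps)
    then show ?thesis unfolding cutoff_def flat_def by (auto simp: not_less)
  qed
  moreover have "0 < 1 / ?n" "1 / ?n < 1 - 1 / ?n" "1 - 1 / ?n < 1"
    by (auto simp: field_simps)
  ultimately show ?thesis using smooth_cutoff unfolding test_funs_iff by blast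
qed

lemma tendsto_flat_one:
  assumes "x > 0" shows "(\<lambda>k. flat 1 (real (k + 3) * x - 1)) \<longlonglongrightarrow> 1"
proof -
  have lim: "filterlim (\<lambda>k. real (k + 3) * x - 1) at_top sequentially"
  proof (rule filterlim_at_top_mono)
    show "filterlim (\<lambda>k. - 1 + x * real k) at_top sequentially"
      by (intro filterlim_tendsto_add_at_top[OF tendsto_const]
          filterlim_tendsto_pos_mult_at_top[OF tendsto_const assms filterlim_real_sequentially])
    show "\<forall>\<^sub>F k in sequentially. - 1 + x * real k \<le> real (k + 3) * x - 1"
      using assms by (intro always_eventually allI) (simp add: algebra_simps)
  qed
  have "((\<lambda>y. complex_of_real (exp (- inverse y))) \<longlongrightarrow> of_real (exp (- 0))) at_top"
    by (intro tendsto_intros tendsto_inverse_0_at_top filterlim_ident)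
  moreover have "\<forall>\<^sub>F y in at_top. complex_of_real (exp (- inverse y)) = flat 1 y"
    using eventually_gt_at_top[of 0] by eventually_elim (simp add: flat_def divide_inverse)
  ultimately have "(flat 1 \<longlongrightarrow> 1) at_top"
    using Lim_transform_eventually by force
  from filterlim_compose[OF this lim] show ?thesis .
qed

lemma tendsto_cutoff:
  assumes "0 < x" "x < 1" shows "(\<lambda>k. cutoff k x) \<longlonglongrightarrow> 1"
  using tendsto_mult[OF tendsto_flat_one[of x] tendsto_flat_one[of "1 - x"]] assms
  unfolding cutoff_def by simp

section \<open>The fundamental lemma of the calculus of variations\<close>

lemma bounded_on_unit:
  fixes f :: "real \<Rightarrow> complex"
  assumes "continuous_on {0..1} f"
  obtains B where "B > 0" "\<And>x. x \<in> {0..1} \<Longrightarrow> norm (f x) \<le> B"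
proof -
  have "bounded (f ` {0..1})"
    using assms by (simp add: compact_continuous_image compact_imp_bounded)
  then show ?thesis using that unfolding bounded_pos by auto
qed

lemma ae_eq_0_of_integral_eq_0:
  assumes i: "h integrable_on {0..1::real}" and pos: "\<And>x. 0 \<le> h x" and zero: "integral {0..1} h = 0"
  shows "(\<lambda>x. complex_of_real (h x)) \<simeq> (\<lambda>x. 0)"
proof -
  have "h absolutely_integrable_on {0..1}"
    using i pos by (simp add: absolutely_integrable_on_iff_nonneg)
  then have li: "integrable (lebesgue_on {0..1}) h"
    by (rule absolutely_integrable_imp_integrable) simp
  then have "integral\<^sup>L (lebesgue_on {0..1}) h = 0"
    using lebesgue_integral_eq_integral[OF li] zero by simp
  then have "AE x in lebesgue_on {0..1}. h x = 0"
    using integral_nonneg_eq_0_iff_AE[OF li] pos by simp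
  then have "AE x in lebesgue. x \<in> {0..1} \<longrightarrow> h x = 0"
    by (subst (asm) AE_restrict_space_iff) auto
  then obtain N where "N \<in> null_sets lebesgue" "{x \<in> space lebesgue. \<not> (x \<in> {0..1} \<longrightarrow> h x = 0)} \<subseteq> N"
    unfolding eventually_ae_filter by auto
  then have "negligible N" "\<forall>x\<in>{0..1} - N. complex_of_real (h x) = 0"
    by (auto simp: negligible_iff_null_sets)
  then show ?thesis unfolding ae_eq_def by blast
qed

text \<open>Cutoffs carry the hypothesis from test functions to polynomials, and bounded polynomial
  approximation carries it on to the clamped conjugate \<open>s\<close> of \<open>g\<close>. The
  product of \<open>g\<close> and \<open>s\<close> is nonnegative with zero integral, hence zero
  almost everywhere.\<close>

lemma fundamental_lemma:
  assumes g: "g \<in> L1" and zero: "\<And>z. z \<in> test_funs \<Longrightarrow> integral {0..1} (\<lambda>x. g x * z x) = 0"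
  shows "g \<simeq> (\<lambda>x. 0)"
proof -
  have poly: "integral {0..1} (\<lambda>x. g x * p x) = 0" if p: "polynomial_function p" for p
  proof -
    obtain B where B: "B > 0" "\<And>x. x \<in> {0..1} \<Longrightarrow> norm (p x) \<le> B"
      using bounded_on_unit[OF continuous_polynomial_function[OF p]] by metis
    have t: "(\<lambda>x. p x * cutoff k x) \<in> test_funs" for k
      by (intro test_funs_mult cutoff_test_funs polynomial_function_smooth p)
    have "(\<lambda>k. integral {0..1} (\<lambda>x. g x * (p x * cutoff k x))) \<longlonglongrightarrow> integral {0..1} (\<lambda>x. g x * p x)"
    proof (rule dominated_convergence_ae[where h="\<lambda>x. B * norm (g x)" and N="{0, 1}"])
      show "(\<lambda>x. g x * (p x * cutoff k x)) integrable_on {0..1}" for k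
        by (intro L1_integrable L1_mult_continuous g test_funs_continuous_on t)
      show "(\<lambda>x. B * norm (g x)) integrable_on {0..1}"
        by (intro integrable_on_mult_right L1_norm_integrable g)
      show "norm (g x * (p x * cutoff k x)) \<le> B * norm (g x)" if "x \<in> {0..1}" for k x
      proof -
        have "norm (p x) * norm (cutoff k x) \<le> B * 1"
          using B norm_cutoff that by (intro mult_mono) auto
        then have "norm (g x) * (norm (p x) * norm (cutoff k x)) \<le> norm (g x) * B"
          by (intro mult_left_mono) auto
        then show ?thesis by (simp add: norm_mult mult_ac)
      qed
      show "(\<lambda>k. g x * (p x * cutoff k x)) \<longlonglongrightarrow> g x * p x" if "x \<in> {0..1} - {0, 1}" for x
      proof -
        have "(\<lambda>k. g x * (p x * cutoff k x)) \<longlonglongrightarrow> g x * (p x * 1)"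
          using that by (intro tendsto_intros tendsto_cutoff) auto
        then show ?thesis by simp
      qed
    qed auto
    then show ?thesis using zero[OF t] by (simp add: LIMSEQ_const_iff)
  qed
  \<comment> \<open>The conjugate itself would give |g|^2, which need not be integrable for
    \<open>g\<close> in L_1. Clamping gives |g|^2 / max(1, |g|), which is integrable and vanishes
    exactly where \<open>g\<close> does.\<close>
  define s where "s x = clamp_norm 1 (cnj (g x))" for x
  have cm: "(\<lambda>x. cnj (g x)) \<in> borel_measurable (lebesgue_on {0..1})"
    by (rule borel_measurable_continuous_on[OF _ L1_measurable[OF g]]) (intro continuous_intros)
  obtain N p where N: "negligible N" and p: "\<And>k::nat. polynomial_function (p k)"
    "\<And>k x. x \<in> {0..1} \<Longrightarrow> norm (p k x) \<le> 1 + 1"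
    "\<And>x. x \<in> {0..1} - N \<Longrightarrow> (\<lambda>k. p k x) \<longlonglongrightarrow> s x"
    using bounded_polynomial_approx[OF cm zero_less_one] unfolding s_def by metis
  have "(\<lambda>k. integral {0..1} (\<lambda>x. g x * p k x)) \<longlonglongrightarrow> integral {0..1} (\<lambda>x. g x * s x)"
  proof (rule dominated_convergence_ae[where h="\<lambda>x. 2 * norm (g x)", OF _ _ _ N])
    show "(\<lambda>x. g x * p k x) integrable_on {0..1}" for k
      by (intro L1_integrable L1_mult_continuous g continuous_polynomial_function p)
    show "(\<lambda>x. 2 * norm (g x)) integrable_on {0..1}"
      by (intro integrable_on_mult_right L1_norm_integrable g)
    show "norm (g x * p k x) \<le> 2 * norm (g x)" if "x \<in> {0..1}" for k x
      using mult_left_mono[OF p(2)[OF that, of k], of "norm (g x)"] by (simp add: norm_mult mult_ac)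
    show "(\<lambda>k. g x * p k x) \<longlonglongrightarrow> g x * s x" if "x \<in> {0..1} - N" for x
      using p(3)[OF that] by (rule tendsto_mult_left)
  qed
  then have 0: "integral {0..1} (\<lambda>x. g x * s x) = 0"
    using poly[OF p(1)] by (simp add: LIMSEQ_const_iff)
  define h where "h x = (norm (g x))\<^sup>2 / max 1 (norm (g x))" for x
  have gs: "g x * s x = complex_of_real (h x)" for x
    unfolding s_def clamp_norm_def h_def
    by (simp add: scaleR_conv_of_real complex_norm_square[symmetric] mult.left_commute)
  have "(\<lambda>x. g x * s x) \<in> L1"
  proof (rule L1_mult_measurable[OF g])
    show "s \<in> borel_measurable (lebesgue_on {0..1})"
      unfolding s_def by (rule borel_measurable_continuous_on[OF continuous_on_clamp_norm cm]) simp
    show "bounded (s ` {0..1})"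
      unfolding bounded_iff s_def using norm_clamp_norm[of 1] by auto
  qed
  then have hL: "(\<lambda>x. complex_of_real (h x)) integrable_on {0..1}"
    unfolding gs by (rule L1_integrable)
  have hi: "h integrable_on {0..1}"
    using integrable_linear[OF hL bounded_linear_Re] by (simp add: o_def)
  have hz: "integral {0..1} h = 0"
    using integral_linear[OF hL bounded_linear_Re] 0 unfolding gs by (simp add: o_def)
  have "(\<lambda>x. complex_of_real (h x)) \<simeq> (\<lambda>x. 0)"
    by (rule ae_eq_0_of_integral_eq_0[OF hi _ hz]) (simp add: h_def)
  then show ?thesis
    by (rule ae_eq_mono) (auto simp: h_def max_def split: if_splits)
qed

section \<open>Primitives\<close>

definition prim :: "(real \<Rightarrow> complex) \<Rightarrow> real \<Rightarrow> complex" where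
  "prim f x = integral {0..x} f"

lemma L1_integrable_sub: "f \<in> L1 \<Longrightarrow> x \<in> {0..1} \<Longrightarrow> f integrable_on {0..x}"
  by (rule integrable_on_subinterval[OF L1_integrable]) auto

lemma L1_norm_integrable_sub: "f \<in> L1 \<Longrightarrow> x \<in> {0..1} \<Longrightarrow> (\<lambda>x. norm (f x)) integrable_on {0..x}"
  by (rule integrable_on_subinterval[OF L1_norm_integrable]) auto

lemma continuous_on_prim: "f \<in> L1 \<Longrightarrow> continuous_on {0..1} (prim f)"
  unfolding prim_def by (rule indefinite_integral_continuous_1[OF L1_integrable])

lemma prim_add: "f \<in> L1 \<Longrightarrow> g \<in> L1 \<Longrightarrow> x \<in> {0..1} \<Longrightarrow> prim (\<lambda>x. f x + g x) x = prim f x + prim g x"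
  unfolding prim_def by (intro integral_add L1_integrable_sub)

lemma prim_diff: "f \<in> L1 \<Longrightarrow> g \<in> L1 \<Longrightarrow> x \<in> {0..1} \<Longrightarrow> prim (\<lambda>x. f x - g x) x = prim f x - prim g x"
  unfolding prim_def by (intro integral_diff L1_integrable_sub)

lemma prim_cong: "(\<And>x. x \<in> {0..1} \<Longrightarrow> f x = g x) \<Longrightarrow> x \<in> {0..1} \<Longrightarrow> prim f x = prim g x"
  unfolding prim_def by (rule integral_cong) auto

lemma norm_prim_le:
  assumes f: "f \<in> L1" and x: "x \<in> {0..1}" shows "norm (prim f x) \<le> integral {0..1} (\<lambda>x. norm (f x))"
proof -
  have "norm (prim f x) \<le> integral {0..x} (\<lambda>x. norm (f x))"
    unfolding prim_def using x by (intro integral_norm_bound_integral L1_integrable_sub L1_norm_integrable_sub f) auto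
  also have "\<dots> \<le> integral {0..1} (\<lambda>x. norm (f x))"
    using x by (intro integral_subset_le L1_norm_integrable_sub L1_norm_integrable f) auto
  finally show ?thesis .
qed

lemma has_vector_derivative_prim:
  assumes "continuous_on {0..1} f" "x \<in> {0..1}"
  shows "(prim f has_vector_derivative f x) (at x within {0..1})"
  unfolding prim_def using integral_has_vector_derivative[OF assms] .

lemma integral_mult_bound:
  assumes f: "f \<in> L1" and g: "continuous_on {0..1} g" and B: "\<And>x. x \<in> {0..1} \<Longrightarrow> norm (g x) \<le> B"
  shows "norm (integral {0..1} (\<lambda>x. f x * g x)) \<le> B * integral {0..1} (\<lambda>x. norm (f x))"
proof -
  have "norm (integral {0..1} (\<lambda>x. f x * g x)) \<le> integral {0..1} (\<lambda>x. B * norm (f x))"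
  proof (rule integral_norm_bound_integral)
    show "(\<lambda>x. f x * g x) integrable_on {0..1}"
      by (intro L1_integrable L1_mult_continuous f g)
    show "(\<lambda>x. B * norm (f x)) integrable_on {0..1}"
      by (intro integrable_on_mult_right L1_norm_integrable f)
    show "norm (f x * g x) \<le> B * norm (f x)" if "x \<in> {0..1}" for x
      using mult_left_mono[OF B[OF that], of "norm (f x)"] by (simp add: norm_mult mult_ac)
  qed
  then show ?thesis by simp
qed

text \<open>For a polynomial \<open>h\<close> this is the product rule with the fundamental theorem
  of calculus. Both integrals are bounded by a multiple of the L_1 norm of \<open>h\<close>, so
  density of polynomials settles the general case without differentiating \<open>prim h\<close>
  almost everywhere.\<close>

lemma prim_by_parts:
  assumes h: "h \<in> L1" and z: "z \<in> test_funs"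
  shows "integral {0..1} (\<lambda>x. prim h x * cderiv z x) = - integral {0..1} (\<lambda>x. h x * z x)"
proof -
  have zc: "continuous_on {0..1} z" and zc': "continuous_on {0..1} (cderiv z)"
    using z by (auto intro: test_funs_continuous_on test_funs_cderiv)
  let ?E = "\<lambda>h. integral {0..1} (\<lambda>x. prim h x * cderiv z x) + integral {0..1} (\<lambda>x. h x * z x)"
  have poly: "?E p = 0" if p: "polynomial_function p" for p
  proof -
    have pc: "continuous_on {0..1} p" by (rule continuous_polynomial_function[OF p])
    have "((\<lambda>x. prim p x * cderiv z x + p x * z x) has_integral (prim p 1 * z 1 - prim p 0 * z 0)) {0..1}"
    proof (rule fundamental_theorem_of_calculus)
      fix x :: real assume "x \<in> {0..1}"
      then show "((\<lambda>x. prim p x * z x) has_vector_derivative prim p x * cderiv z x + p x * z x) (at x within {0..1})"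
        by (rule has_vector_derivative_mult[OF has_vector_derivative_prim[OF pc]
            has_vector_derivative_at_within[OF smooth_has_vector_derivative[OF test_funs_smooth[OF z]]]])
    qed simp
    moreover have "z 1 = 0" "z 0 = 0" using z unfolding test_funs_iff by force+
    ultimately have "integral {0..1} (\<lambda>x. prim p x * cderiv z x + p x * z x) = 0"
      by (simp add: integral_unique)
    moreover have "(\<lambda>x. prim p x * cderiv z x) \<in> L1" "(\<lambda>x. p x * z x) \<in> L1"
      by (intro L1_mult_continuous L1_continuous continuous_on_prim zc zc' pc)+
    ultimately show ?thesis using integral_add[OF L1_integrable L1_integrable] by metis
  qed
  obtain B where B: "B > 0" "\<And>x. x \<in> {0..1} \<Longrightarrow> norm (z x) \<le> B"
    using bounded_on_unit[OF zc] by metis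
  obtain B' where B': "B' > 0" "\<And>x. x \<in> {0..1} \<Longrightarrow> norm (cderiv z x) \<le> B'"
    using bounded_on_unit[OF zc'] by metis
  have bound: "norm (?E f) \<le> (B' + B) * integral {0..1} (\<lambda>x. norm (f x))" if f: "f \<in> L1" for f
  proof -
    let ?n = "integral {0..1} (\<lambda>x. norm (f x))"
    have "norm (integral {0..1} (\<lambda>x. prim f x * cderiv z x)) \<le> B' * integral {0..1} (\<lambda>x. norm (prim f x))"
      by (intro integral_mult_bound L1_continuous continuous_on_prim f zc' B')
    also have "\<dots> \<le> B' * integral {0..1::real} (\<lambda>x. ?n)"
      using B'(1) norm_prim_le[OF f]
      by (intro mult_left_mono integral_le L1_norm_integrable L1_continuous continuous_on_prim f) auto
    finally have "norm (integral {0..1} (\<lambda>x. prim f x * cderiv z x)) \<le> B' * ?n" by simp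
    moreover have "norm (integral {0..1} (\<lambda>x. f x * z x)) \<le> B * ?n"
      by (intro integral_mult_bound f zc B)
    ultimately show ?thesis by (intro norm_triangle_le) (simp add: distrib_right)
  qed
  have "norm (?E h) \<le> 0"
  proof (rule field_le_epsilon)
    fix e :: real assume e: "e > 0"
    then obtain p where p: "polynomial_function p" "integral {0..1} (\<lambda>x. norm (p x - h x)) < e / (B' + B)"
      using L1_polynomial_approx[OF h, of "e / (B' + B)"] B(1) B'(1) by auto
    have pL: "p \<in> L1" by (intro L1_continuous continuous_polynomial_function p)
    have i: "(\<lambda>x. prim p x * cderiv z x) \<in> L1" "(\<lambda>x. prim h x * cderiv z x) \<in> L1"
      "(\<lambda>x. p x * z x) \<in> L1" "(\<lambda>x. h x * z x) \<in> L1"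
      by (intro L1_mult_continuous L1_continuous continuous_on_prim zc zc' pL h)+
    have "integral {0..1} (\<lambda>x. prim (\<lambda>x. p x - h x) x * cderiv z x)
       = integral {0..1} (\<lambda>x. prim p x * cderiv z x - prim h x * cderiv z x)"
      by (rule integral_cong) (simp add: prim_diff pL h left_diff_distrib)
    then have "?E (\<lambda>x. p x - h x) = ?E p - ?E h"
      using integral_diff[OF L1_integrable[OF i(1)] L1_integrable[OF i(2)]]
        integral_diff[OF L1_integrable[OF i(3)] L1_integrable[OF i(4)]]
      by (simp add: left_diff_distrib)
    then have "norm (?E h) = norm (?E (\<lambda>x. p x - h x))"
      using poly[OF p(1)] by (metis diff_0 norm_minus_cancel)
    also have "\<dots> \<le> (B' + B) * integral {0..1} (\<lambda>x. norm (p x - h x))"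
      by (intro bound L1_diff pL h)
    also have "\<dots> \<le> e" using p(2) B(1) B'(1) by (simp add: field_simps)
    finally show "norm (?E h) \<le> 0 + e" by simp
  qed
  then show ?thesis by (simp add: eq_neg_iff_add_eq_0)
qed

section \<open>Weak derivatives\<close>

text \<open>The type \<open>distr\<close> contains arbitrary functionals; linearity is what the du
  Bois-Reymond argument takes from a distribution.\<close>

definition linear_distr :: "distr \<Rightarrow> bool" where
  "linear_distr Q \<longleftrightarrow>
     (\<forall>z\<in>test_funs. \<forall>w\<in>test_funs. Q (\<lambda>x. z x + w x) = Q z + Q w) \<and>
     (\<forall>z\<in>test_funs. \<forall>c. Q (\<lambda>x. c * z x) = c * Q z)"

lemma linear_distrD:
  assumes "linear_distr Q" "z \<in> test_funs"
  shows "w \<in> test_funs \<Longrightarrow> Q (\<lambda>x. z x + w x) = Q z + Q w" "Q (\<lambda>x. c * z x) = c * Q z"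
  using assms unfolding linear_distr_def by blast+

lemma L1_mult_test_funs: "f \<in> L1 \<Longrightarrow> z \<in> test_funs \<Longrightarrow> (\<lambda>x. f x * z x) \<in> L1"
  by (intro L1_mult_continuous test_funs_continuous_on)

lemma linear_distr_of:
  assumes "f \<in> L1" shows "linear_distr (distr_of f)"
  unfolding linear_distr_def distr_of_def
proof (intro conjI ballI allI)
  fix z w assume "z \<in> test_funs" "w \<in> test_funs"
  then have "(\<lambda>x. f x * z x) integrable_on {0..1}" "(\<lambda>x. f x * w x) integrable_on {0..1}"
    by (auto intro: L1_integrable L1_mult_test_funs assms)
  from integral_add[OF this]
  show "integral {0..1} (\<lambda>x. f x * (z x + w x)) = integral {0..1} (\<lambda>x. f x * z x) + integral {0..1} (\<lambda>x. f x * w x)"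
    by (simp add: distrib_left)
next
  fix z c
  have "(\<lambda>x. f x * (c * z x)) = (\<lambda>x. c * (f x * z x))" by (simp add: mult.left_commute)
  then show "integral {0..1} (\<lambda>x. f x * (c * z x)) = c * integral {0..1} (\<lambda>x. f x * z x)" by simp
qed

lemma linear_distr_deriv: "linear_distr Q \<Longrightarrow> linear_distr (distr_deriv Q)"
  unfolding linear_distr_def distr_deriv_def
  by (auto simp: cderiv_add cderiv_cmult test_funs_smooth test_funs_cderiv)

lemma linear_distr_diff: "linear_distr Q \<Longrightarrow> linear_distr R \<Longrightarrow> linear_distr (\<lambda>z. Q z - R z)"
  unfolding linear_distr_def by (auto simp: algebra_simps)

lemma distr_of_add:
  assumes "f \<in> L1" "g \<in> L1" "z \<in> test_funs"
  shows "distr_of (\<lambda>x. f x + g x) z = distr_of f z + distr_of g z"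
proof -
  have "(\<lambda>x. f x * z x) integrable_on {0..1}" "(\<lambda>x. g x * z x) integrable_on {0..1}"
    by (auto intro: L1_integrable L1_mult_test_funs assms)
  from integral_add[OF this] show ?thesis unfolding distr_of_def by (simp add: distrib_right)
qed

lemma distr_of_cmult: "distr_of (\<lambda>x. c * f x) z = c * distr_of f z"
  unfolding distr_of_def by (simp add: mult.assoc)

lemma distr_of_diff:
  assumes "f \<in> L1" "g \<in> L1" "z \<in> test_funs"
  shows "distr_of (\<lambda>x. f x - g x) z = distr_of f z - distr_of g z"
  using distr_of_add[OF assms(1) L1_cmult[OF assms(2), of "-1"] assms(3)]
  unfolding distr_of_cmult by simp

lemma distr_of_inj:
  assumes "f \<in> L1" "g \<in> L1" "distr_of f \<doteq> distr_of g"
  shows "f \<simeq> g"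
proof -
  have "(\<lambda>x. f x - g x) \<simeq> (\<lambda>x. 0)"
  proof (rule fundamental_lemma[OF L1_diff[OF assms(1,2)]])
    fix z assume z: "z \<in> test_funs"
    then have "distr_of (\<lambda>x. f x - g x) z = 0"
      using assms(3) distr_of_diff[OF assms(1,2) z] unfolding distr_eq_def by simp
    then show "integral {0..1} (\<lambda>x. (f x - g x) * z x) = 0" unfolding distr_of_def .
  qed
  then show ?thesis by (rule ae_eq_mono) simp
qed

text \<open>The primitive vanishes to the left of the support of \<open>z\<close>, and the zero mean
  makes it vanish to the right as well.\<close>

lemma test_funs_primitive:
  assumes z: "z \<in> test_funs" and zero: "integral {0..1} z = 0"
  obtains w where "w \<in> test_funs" "cderiv w = z"
proof -
  obtain a b where ab: "0 < a" "a < b" "b < 1" and out: "\<And>x. x \<notin> {a..b} \<Longrightarrow> z x = 0"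
    using z unfolding test_funs_iff by metis
  \<comment> \<open>A point strictly between the support and 1: \<open>z\<close> vanishes on [c, 1],
    so the primitive is constant there and equal to its value at 1, the mean of
    \<open>z\<close>.\<close>
  define c where "c = (b + 1) / 2"
  have c: "b < c" "c < 1" "0 < c" using ab by (auto simp: c_def)
  have zi: "z integrable_on {s..t}" for s t
    by (rule integrable_continuous_real[OF test_funs_continuous_on[OF z]])
  define w where "w x = integral {0..x} z" for x
  \<comment> \<open>This includes \<open>x < 0\<close>, where the interval {0..x} is empty and the
    integral is 0 by convention.\<close>
  have left: "w x = 0" if "x < a" for x
  proof -
    have "integral {0..x} z = integral {0..x} (\<lambda>x. 0)"
      using that out by (intro integral_cong) auto
    then show ?thesis by (simp add: w_def)
  qed
  have right: "w x = w c" if "c \<le> x" for x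
  proof -
    have "integral {c..x} z = integral {c..x} (\<lambda>x. 0)"
      using c out by (intro integral_cong) auto
    moreover have "integral {0..c} z + integral {c..x} z = integral {0..x} z"
      using c that by (intro Henstock_Kurzweil_Integration.integral_combine zi) auto
    ultimately show ?thesis by (simp add: w_def)
  qed
  have "w c = 0" using right[of 1] c zero by (simp add: w_def)
  then have out_w: "w x = 0" if "x \<notin> {a..c}" for x
    using that left[of x] right[of x] by auto
  have deriv: "(w has_vector_derivative z x) (at x)" for x
  proof (cases "x < a")
    case True
    have "((\<lambda>x. 0::complex) has_vector_derivative 0) (at x)" by simp
    then have "(w has_vector_derivative 0) (at x)"
      by (rule has_vector_derivative_transform_within_open[where S="{..<a}"]) (use True left in auto)
    then show ?thesis using out True by simp
  next
    case False
    then have x: "0 < x" using ab by simp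
    have "(w has_vector_derivative z x) (at x within {0..x + 1})"
      unfolding w_def by (rule integral_has_vector_derivative[OF test_funs_continuous_on[OF z]]) (use x in simp)
    then show ?thesis using at_within_Icc_at[of 0 x "x + 1"] x by simp
  qed
  have "smooth w"
    by (rule smooth_coinduct[where P="\<lambda>f. f = w \<or> smooth f"])
      (use deriv smooth_cderiv smooth_has_vector_derivative test_funs_smooth[OF z] in blast)+
  then have "w \<in> test_funs" using out_w ab c unfolding test_funs_iff
    by (intro conjI exI[of _ a] exI[of _ c]) auto
  then show thesis using that cderiv_eq[OF deriv] by blast
qed

text \<open>If all test functions had zero mean, the fundamental lemma would make the constant 1
  vanish almost everywhere.\<close>

lemma test_funs_integral_one: obtains z where "z \<in> test_funs" "integral {0..1} z = 1"
proof -
  have "\<exists>z\<in>test_funs. integral {0..1} z \<noteq> 0"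
  proof (rule ccontr)
    assume "\<not> ?thesis"
    then have "(\<lambda>x. 1) \<simeq> (\<lambda>x. 0)"
      by (intro fundamental_lemma L1_continuous) auto
    from integral_cong_ae_eq[OF this] show False by simp
  qed
  then obtain z where z: "z \<in> test_funs" "integral {0..1} z \<noteq> 0" by blast
  then show thesis
    using that[OF test_funs_cmult[OF z(1), of "1 / integral {0..1} z"]] by simp
qed

text \<open>Subtracting from \<open>z\<close> the multiple of a fixed bump \<open>p\<close> of mass
  one that has the same integral leaves a test function with zero mean. It is the derivative of a
  test function, so \<open>Q\<close> annihilates it, and \<open>Q z\<close> is \<open>Q p\<close>
  times the integral of \<open>z\<close>.\<close>

lemma du_bois_reymond:
  assumes Q: "linear_distr Q" and zero: "\<And>z. z \<in> test_funs \<Longrightarrow> Q (cderiv z) = 0"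
  obtains c where "Q \<doteq> distr_of (\<lambda>x. c)"
proof -
  obtain p where p: "p \<in> test_funs" "integral {0..1} p = 1" by (rule test_funs_integral_one)
  have "Q z = Q p * integral {0..1} z" if z: "z \<in> test_funs" for z
  proof -
    let ?c = "- integral {0..1} z"
    have cp: "(\<lambda>x. ?c * p x) \<in> test_funs" by (rule test_funs_cmult[OF p(1)])
    have i: "z integrable_on {0..1}" "(\<lambda>x. ?c * p x) integrable_on {0..1}"
      by (intro L1_integrable L1_continuous test_funs_continuous_on z cp)+
    have "integral {0..1} (\<lambda>x. z x + ?c * p x) = 0"
      using integral_add[OF i] p(2) by simp
    then obtain w where "w \<in> test_funs" "cderiv w = (\<lambda>x. z x + ?c * p x)"
      using test_funs_primitive[OF test_funs_add[OF z cp]] by metis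
    then have "Q (\<lambda>x. z x + ?c * p x) = 0" using zero by metis
    then have "Q z + ?c * Q p = 0"
      using linear_distrD(1)[OF Q z cp] linear_distrD(2)[OF Q p(1), of ?c] by metis
    then show ?thesis by (simp add: mult.commute)
  qed
  then have "Q \<doteq> distr_of (\<lambda>x. Q p)" unfolding distr_eq_def distr_of_def by simp
  then show thesis by (rule that)
qed

lemma L1_const: "(\<lambda>x. c) \<in> L1"
  by (rule L1_continuous) simp

lemma L1_prim: "h \<in> L1 \<Longrightarrow> prim h \<in> L1"
  by (rule L1_continuous[OF continuous_on_prim])

lemma L1_const_plus_prim: "h \<in> L1 \<Longrightarrow> (\<lambda>x. c + prim h x) \<in> L1"
  by (rule L1_add[OF L1_const L1_prim])

lemma distr_deriv_const_plus_prim: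
  assumes "h \<in> L1" shows "distr_deriv (distr_of (\<lambda>x. c + prim h x)) \<doteq> distr_of h"
  unfolding distr_eq_def
proof
  fix z assume z: "z \<in> test_funs"
  note z' = test_funs_cderiv[OF z]
  have "distr_of (\<lambda>x. c + prim h x) (cderiv z) = distr_of (\<lambda>x. c) (cderiv z) + distr_of (prim h) (cderiv z)"
    by (intro distr_of_add z' L1_const L1_prim assms)
  also have "\<dots> = - distr_of h z"
    using prim_by_parts[OF assms z] integral_cderiv_test_funs[OF z] by (simp add: distr_of_def)
  finally show "distr_deriv (distr_of (\<lambda>x. c + prim h x)) z = distr_of h z"
    by (simp add: distr_deriv_def)
qed

text \<open>\<open>Q\<close> and the primitive of \<open>h\<close> have the same distributional
  derivative, so du Bois-Reymond applies to their difference.\<close>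

lemma distr_primitive:
  assumes Q: "linear_distr Q" and h: "h \<in> L1" and eq: "distr_deriv Q \<doteq> distr_of h"
  obtains c where "Q \<doteq> distr_of (\<lambda>x. c + prim h x)"
proof -
  let ?p = "\<lambda>x. 0 + prim h x"
  have pL: "?p \<in> L1" by (rule L1_const_plus_prim[OF h])
  have "linear_distr (\<lambda>z. Q z - distr_of ?p z)"
    by (intro linear_distr_diff Q linear_distr_of pL)
  moreover have "Q (cderiv z) - distr_of ?p (cderiv z) = 0" if "z \<in> test_funs" for z
  proof -
    have "- Q (cderiv z) = - distr_of ?p (cderiv z)"
      using eq distr_deriv_const_plus_prim[OF h, of 0] that unfolding distr_eq_def distr_deriv_def by metis
    then show ?thesis by simp
  qed
  ultimately obtain c where c: "(\<lambda>z. Q z - distr_of ?p z) \<doteq> distr_of (\<lambda>x. c)"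
    using du_bois_reymond by blast
  have "Q z = distr_of (\<lambda>x. c + prim h x) z" if z: "z \<in> test_funs" for z
  proof -
    have "(\<lambda>x. c) \<in> L1" by (simp add: L1_continuous)
    from distr_of_add[OF this pL z] show ?thesis
      using c z unfolding distr_eq_def by (simp add: algebra_simps)
  qed
  then show thesis using that unfolding distr_eq_def by blast
qed

section \<open>Calculus in W_1^1\<close>

lemma has_L1_deriv_L1: "has_L1_deriv u g \<Longrightarrow> g \<in> L1"
  by (simp add: has_L1_deriv_def)

lemma has_L1_deriv_iff:
  "has_L1_deriv u g \<longleftrightarrow> g \<in> L1 \<and> (\<forall>z\<in>test_funs. distr_of u (cderiv z) = - distr_of g z)"
  unfolding has_L1_deriv_def distr_eq_def distr_deriv_def by (auto simp: minus_equation_iff)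

lemma has_L1_deriv_prim: "h \<in> L1 \<Longrightarrow> has_L1_deriv (\<lambda>x. c + prim h x) h"
  unfolding has_L1_deriv_def using distr_deriv_const_plus_prim by blast

lemma has_L1_deriv_cong: "u \<simeq> v \<Longrightarrow> has_L1_deriv u = has_L1_deriv v"
  unfolding has_L1_deriv_def by (simp add: distr_of_cong)

text \<open>A genuine equality of functions: both sides are the same choice from the same set of
  derivatives. It makes iterates of \<open>L1_deriv\<close> insensitive to changes on null
  sets.\<close>

lemma L1_deriv_cong: "u \<simeq> v \<Longrightarrow> L1_deriv u = L1_deriv v"
  unfolding L1_deriv_def by (simp add: has_L1_deriv_cong)

lemma has_L1_deriv_cong_right: "has_L1_deriv u g \<Longrightarrow> g \<simeq> h \<Longrightarrow> has_L1_deriv u h"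
  unfolding has_L1_deriv_def using distr_of_cong L1_cong_ae_eq by metis

lemma has_L1_deriv_unique: "has_L1_deriv u g \<Longrightarrow> has_L1_deriv u h \<Longrightarrow> g \<simeq> h"
  by (rule distr_of_inj) (auto simp: has_L1_deriv_def distr_eq_def)

lemma W11I: "u \<in> L1 \<Longrightarrow> has_L1_deriv u g \<Longrightarrow> u \<in> W11"
  unfolding W11_def by blast

lemma W11_L1: "u \<in> W11 \<Longrightarrow> u \<in> L1"
  unfolding W11_def by blast

lemma has_L1_deriv_L1_deriv: "u \<in> W11 \<Longrightarrow> has_L1_deriv u (L1_deriv u)"
  unfolding W11_def L1_deriv_def using someI_ex[of "has_L1_deriv u"] by blast

lemma L1_deriv_L1: "u \<in> W11 \<Longrightarrow> L1_deriv u \<in> L1"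
  using has_L1_deriv_L1_deriv has_L1_deriv_L1 by blast

lemma L1_derivI: "has_L1_deriv u g \<Longrightarrow> L1_deriv u \<simeq> g"
  unfolding L1_deriv_def by (rule has_L1_deriv_unique[OF someI[of "has_L1_deriv u"]])

lemma W11_cong: "u \<simeq> v \<Longrightarrow> u \<in> W11 \<Longrightarrow> v \<in> W11"
  unfolding W11_def using L1_cong_ae_eq has_L1_deriv_cong by auto

text \<open>Integrating the derivative reproduces \<open>u\<close> up to a constant. The continuous
  representative is what permits multiplication by L_1 functions.\<close>

lemma W11_continuous:
  assumes "u \<in> W11" obtains v where "continuous_on {0..1} v" "u \<simeq> v"
proof -
  have u: "u \<in> L1" "L1_deriv u \<in> L1" "distr_deriv (distr_of u) \<doteq> distr_of (L1_deriv u)"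
    using assms W11_L1 L1_deriv_L1 has_L1_deriv_L1_deriv has_L1_deriv_def by auto
  obtain c where "distr_of u \<doteq> distr_of (\<lambda>x. c + prim (L1_deriv u) x)"
    using distr_primitive[OF linear_distr_of[OF u(1)] u(2,3)] by blast
  then have "u \<simeq> (\<lambda>x. c + prim (L1_deriv u) x)"
    by (rule distr_of_inj[OF u(1) L1_const_plus_prim[OF u(2)]])
  moreover have "continuous_on {0..1} (\<lambda>x. c + prim (L1_deriv u) x)"
    by (intro continuous_intros continuous_on_prim u(2))
  ultimately show thesis using that by blast
qed

lemma L1_mult_W11:
  assumes "f \<in> L1" "u \<in> W11" shows "(\<lambda>x. f x * u x) \<in> L1"
proof -
  obtain v where v: "continuous_on {0..1} v" "u \<simeq> v" using W11_continuous[OF assms(2)] .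
  have "(\<lambda>x. f x * v x) \<simeq> (\<lambda>x. f x * u x)" by (intro ae_eq_mult ae_eq_refl ae_eq_sym[OF v(2)])
  then show ?thesis using L1_mult_continuous[OF assms(1) v(1)] by (rule L1_cong_ae_eq)
qed

lemma has_L1_deriv_add:
  assumes "u \<in> L1" "v \<in> L1" "has_L1_deriv u g" "has_L1_deriv v h"
  shows "has_L1_deriv (\<lambda>x. u x + v x) (\<lambda>x. g x + h x)"
  using assms unfolding has_L1_deriv_iff by (simp add: L1_add distr_of_add test_funs_cderiv)

lemma has_L1_deriv_zero: "has_L1_deriv (\<lambda>x. 0) (\<lambda>x. 0)"
  unfolding has_L1_deriv_iff by (simp add: distr_of_def L1_continuous)

lemma has_L1_deriv_sum:
  assumes "\<And>i. i \<in> A \<Longrightarrow> u i \<in> L1 \<and> has_L1_deriv (u i) (g i)"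
  shows "has_L1_deriv (\<lambda>x. \<Sum>i\<in>A. u i x) (\<lambda>x. \<Sum>i\<in>A. g i x)"
  using assms
  by (induction A rule: infinite_finite_induct)
    (simp_all add: has_L1_deriv_zero has_L1_deriv_add L1_sum)

text \<open>For a test function \<open>w\<close> the product of \<open>z\<close> and
  \<open>w\<close> is again a test function. Testing the derivative of \<open>u\<close> against it
  and using the smooth product rule gives the claim.\<close>

lemma has_L1_deriv_mult_test_funs:
  assumes u: "u \<in> L1" and g: "has_L1_deriv u g" and z: "z \<in> test_funs"
  shows "has_L1_deriv (\<lambda>x. u x * z x) (\<lambda>x. g x * z x + u x * cderiv z x)"
  unfolding has_L1_deriv_iff
proof (intro conjI ballI)
  have gL: "g \<in> L1" using g by (rule has_L1_deriv_L1)
  note z' = test_funs_cderiv[OF z]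
  have L: "(\<lambda>x. g x * z x) \<in> L1" "(\<lambda>x. u x * cderiv z x) \<in> L1" "(\<lambda>x. u x * z x) \<in> L1"
    by (intro L1_mult_test_funs gL u z z')+
  show "(\<lambda>x. g x * z x + u x * cderiv z x) \<in> L1" by (intro L1_add L)
  fix w assume w: "w \<in> test_funs"
  note w' = test_funs_cderiv[OF w]
  have zw: "(\<lambda>x. z x * w x) \<in> test_funs" "(\<lambda>x. z x * cderiv w x) \<in> test_funs" "(\<lambda>x. cderiv z x * w x) \<in> test_funs"
    by (intro test_funs_mult w w' test_funs_smooth z z')+
  have "distr_of u (cderiv (\<lambda>x. z x * w x)) = distr_of u (\<lambda>x. z x * cderiv w x) + distr_of u (\<lambda>x. cderiv z x * w x)"
    unfolding cderiv_mult[OF test_funs_smooth[OF z] test_funs_smooth[OF w]]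
    by (rule linear_distrD(1)[OF linear_distr_of[OF u] zw(2,3)])
  moreover have "distr_of u (cderiv (\<lambda>x. z x * w x)) = - distr_of g (\<lambda>x. z x * w x)"
    using g zw(1) unfolding has_L1_deriv_iff by blast
  ultimately have "distr_of u (\<lambda>x. z x * cderiv w x) = - (distr_of g (\<lambda>x. z x * w x) + distr_of u (\<lambda>x. cderiv z x * w x))"
    by (simp add: algebra_simps)
  then show "distr_of (\<lambda>x. u x * z x) (cderiv w) = - distr_of (\<lambda>x. g x * z x + u x * cderiv z x) w"
    unfolding distr_of_add[OF L(1,2) w] by (simp add: distr_of_def mult.assoc)
qed

section \<open>Sobolev functions\<close>

text \<open>The space W_1^k[0,1], with \<open>sob 0\<close> equal to L_1. Iterating the chosen
  derivatives is harmless because \<open>L1_deriv\<close> depends only on the class of its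
  argument.\<close>

definition sob :: "nat \<Rightarrow> (real \<Rightarrow> complex) set" where
  "sob k = {y \<in> L1. \<forall>i<k. (L1_deriv ^^ i) y \<in> W11}"

lemma sob_W11: "y \<in> sob k \<Longrightarrow> i < k \<Longrightarrow> (L1_deriv ^^ i) y \<in> W11"
  unfolding sob_def by blast

lemma sob_L1: 
  assumes "y \<in> sob k" "i \<le> k" shows "(L1_deriv ^^ i) y \<in> L1"
proof (cases i)
  case 0
  then show ?thesis using assms by (simp add: sob_def)
next
  case (Suc j)
  then show ?thesis using sob_W11[OF assms(1), of j] assms(2) by (auto intro: L1_deriv_L1)
qed

lemma sob_mono: "y \<in> sob k \<Longrightarrow> j \<le> k \<Longrightarrow> y \<in> sob j"
  unfolding sob_def by auto

lemma sob_funpow: 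
  assumes "y \<in> sob (k + j)" shows "(L1_deriv ^^ k) y \<in> sob j"
proof -
  have "(L1_deriv ^^ i) ((L1_deriv ^^ k) y) \<in> W11" if "i < j" for i
    using sob_W11[OF assms, of "i + k"] that by (simp add: funpow_add)
  then show ?thesis unfolding sob_def using sob_L1[OF assms, of k] by simp
qed

text \<open>The iterates of \<open>L1_deriv\<close> are unspecified representatives. A chain of
  explicit functions, each a weak derivative of the one before, identifies them almost
  everywhere.\<close>

lemma sob_chain:
  assumes y: "y \<simeq> v 0" and L: "v k \<in> L1"
    and d: "\<And>i. i < k \<Longrightarrow> v i \<in> L1 \<and> has_L1_deriv (v i) (v (Suc i))"
  shows "y \<in> sob k" "\<And>i. i \<le> k \<Longrightarrow> (L1_deriv ^^ i) y \<simeq> v i"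
proof -
  show *: "(L1_deriv ^^ i) y \<simeq> v i" if "i \<le> k" for i
    using that
  proof (induction i)
    case (Suc i)
    then have "L1_deriv ((L1_deriv ^^ i) y) = L1_deriv (v i)" by (intro L1_deriv_cong) simp
    then show ?case using L1_derivI[of "v i" "v (Suc i)"] d[of i] Suc by simp
  qed (simp add: y)
  have "(L1_deriv ^^ i) y \<in> W11" if "i < k" for i
  proof -
    have "v i \<in> W11" using d[OF that] W11I by blast
    then show ?thesis using W11_cong[OF ae_eq_sym[OF *[of i]]] that by simp
  qed
  moreover have "v 0 \<in> L1" using L d[of 0] by (cases k) auto
  then have "y \<in> L1" using L1_cong_ae_eq[OF ae_eq_sym[OF y]] by simp
  ultimately show "y \<in> sob k" unfolding sob_def by blast
qed

text \<open>The coefficients \<open>\<zeta>\<close> are chosen before \<open>g\<close>: they later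
  enter weights that must serve all functions at once. Their binomial form is left implicit.\<close>

lemma leibniz_test_funs:
  assumes z: "z \<in> test_funs"
  shows "\<exists>\<zeta>. (\<forall>l\<le>i. \<zeta> l \<in> test_funs) \<and>
    (\<forall>g\<in>sob i. (L1_deriv ^^ i) (\<lambda>t. g t * z t) \<simeq> (\<lambda>x. \<Sum>l\<le>i. (L1_deriv ^^ l) g x * \<zeta> l x))"
proof (induction i)
  case 0
  show ?case by (rule exI[of _ "\<lambda>_. z"]) (simp add: z)
next
  case (Suc i)
  then obtain \<zeta> where \<zeta>: "\<And>l. l \<le> i \<Longrightarrow> \<zeta> l \<in> test_funs"
    and ih: "\<And>g. g \<in> sob i \<Longrightarrow> (L1_deriv ^^ i) (\<lambda>t. g t * z t) \<simeq> (\<lambda>x. \<Sum>l\<le>i. (L1_deriv ^^ l) g x * \<zeta> l x)"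
    by blast
  \<comment> \<open>By the product rule, the term with coefficient \<open>\<zeta> l\<close>
    contributes to index l + 1 when \<open>g\<close> is differentiated and to index l when the
    coefficient is. The terms missing at the two ends are set to 0.\<close>
  define \<xi> where "\<xi> l = (\<lambda>x. (if l = 0 then (\<lambda>x. 0) else \<zeta> (l - 1)) x
    + (if l \<le> i then cderiv (\<zeta> l) else (\<lambda>x. 0)) x)" for l
  have "\<xi> l \<in> test_funs" if "l \<le> Suc i" for l
    unfolding \<xi>_def using that by (intro test_funs_add) (auto simp: test_funs_zero test_funs_cderiv \<zeta>)
  moreover have "(L1_deriv ^^ Suc i) (\<lambda>t. g t * z t) \<simeq> (\<lambda>x. \<Sum>l\<le>Suc i. (L1_deriv ^^ l) g x * \<xi> l x)"
    if g: "g \<in> sob (Suc i)" for g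
  proof -
    have 1: "L1_deriv ((L1_deriv ^^ i) (\<lambda>t. g t * z t)) = L1_deriv (\<lambda>x. \<Sum>l\<le>i. (L1_deriv ^^ l) g x * \<zeta> l x)"
      by (rule L1_deriv_cong[OF ih]) (rule sob_mono[OF g], simp)
    have 2: "L1_deriv (\<lambda>x. \<Sum>l\<le>i. (L1_deriv ^^ l) g x * \<zeta> l x) \<simeq> (\<lambda>x. \<Sum>l\<le>i. (L1_deriv ^^ Suc l) g x * \<zeta> l x + (L1_deriv ^^ l) g x * cderiv (\<zeta> l) x)"
    proof (rule L1_derivI[OF has_L1_deriv_sum], rule conjI)
      fix l assume "l \<in> {..i}"
      then have l: "l \<le> i" by simp
      then have w: "(L1_deriv ^^ l) g \<in> W11" using sob_W11[OF g] by simp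
      show "(\<lambda>x. (L1_deriv ^^ l) g x * \<zeta> l x) \<in> L1"
        by (intro L1_mult_test_funs W11_L1 w \<zeta> l)
      show "has_L1_deriv (\<lambda>x. (L1_deriv ^^ l) g x * \<zeta> l x)
        (\<lambda>x. (L1_deriv ^^ Suc l) g x * \<zeta> l x + (L1_deriv ^^ l) g x * cderiv (\<zeta> l) x)"
        using has_L1_deriv_mult_test_funs[OF W11_L1[OF w] has_L1_deriv_L1_deriv[OF w] \<zeta>[OF l]] by simp
    qed
    have 3: "(\<lambda>x. \<Sum>l\<le>i. (L1_deriv ^^ Suc l) g x * \<zeta> l x + (L1_deriv ^^ l) g x * cderiv (\<zeta> l) x)
      = (\<lambda>x. \<Sum>l\<le>Suc i. (L1_deriv ^^ l) g x * \<xi> l x)"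
    proof
      fix x
      have "(\<Sum>l\<le>Suc i. (L1_deriv ^^ l) g x * \<xi> l x) =
         (\<Sum>l\<le>Suc i. (L1_deriv ^^ l) g x * (if l = 0 then (\<lambda>x. 0) else \<zeta> (l - 1)) x)
       + (\<Sum>l\<le>Suc i. (L1_deriv ^^ l) g x * (if l \<le> i then cderiv (\<zeta> l) else (\<lambda>x. 0)) x)"
        unfolding \<xi>_def by (simp only: distrib_left sum.distrib)
      also have "(\<Sum>l\<le>Suc i. (L1_deriv ^^ l) g x * (if l = 0 then (\<lambda>x. 0) else \<zeta> (l - 1)) x)
        = (\<Sum>l\<le>i. (L1_deriv ^^ Suc l) g x * \<zeta> l x)"
        by (subst sum.atMost_Suc_shift) simp
      also have "(\<Sum>l\<le>Suc i. (L1_deriv ^^ l) g x * (if l \<le> i then cderiv (\<zeta> l) else (\<lambda>x. 0)) x)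
        = (\<Sum>l\<le>i. (L1_deriv ^^ l) g x * cderiv (\<zeta> l) x)"
        by simp
      finally show "(\<Sum>l\<le>i. (L1_deriv ^^ Suc l) g x * \<zeta> l x + (L1_deriv ^^ l) g x * cderiv (\<zeta> l) x)
        = (\<Sum>l\<le>Suc i. (L1_deriv ^^ l) g x * \<xi> l x)" by (simp only: sum.distrib)
    qed
    show ?thesis using 1 2 unfolding 3 by simp
  qed
  ultimately show ?case by blast
qed

section \<open>The expression in terms of the derivatives of order at most \<open>m\<close>\<close>

lemma funpow_distr_deriv: "(distr_deriv ^^ k) T z = (-1) ^ k * T ((cderiv ^^ k) z)"
proof (induction k arbitrary: z)
  case (Suc k)
  have "(distr_deriv ^^ Suc k) T z = - (distr_deriv ^^ k) T (cderiv z)"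
    by (simp add: distr_deriv_def)
  also have "\<dots> = (-1) ^ Suc k * T ((cderiv ^^ Suc k) z)"
    unfolding Suc by (simp add: funpow_Suc_right del: funpow.simps)
  finally show ?case .
qed simp

text \<open>The weights are fixed before \<open>y\<close>. No weight meets y^{(m+1)}, which is only
  an L_1 function; the derivatives that do occur have continuous representatives, and a change that
  is uniformly small in all of them changes the value little.\<close>

definition L1_functional :: "nat \<Rightarrow> ((real \<Rightarrow> complex) \<Rightarrow> complex) \<Rightarrow> bool" where
  "L1_functional m \<Phi> \<longleftrightarrow> (\<exists>\<omega>. (\<forall>i\<le>m. \<omega> i \<in> L1) \<and>
     (\<forall>y\<in>sob (Suc m). \<Phi> y = (\<Sum>i\<le>m. integral {0..1} (\<lambda>x. \<omega> i x * (L1_deriv ^^ i) y x))))"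

lemma L1_functionalE:
  assumes "L1_functional m \<Phi>"
  obtains \<omega> where "\<And>i. i \<le> m \<Longrightarrow> \<omega> i \<in> L1"
    "\<And>y. y \<in> sob (Suc m) \<Longrightarrow> \<Phi> y = (\<Sum>i\<le>m. integral {0..1} (\<lambda>x. \<omega> i x * (L1_deriv ^^ i) y x))"
proof -
  from assms obtain \<omega> where w: "\<forall>i\<le>m. \<omega> i \<in> L1"
    "\<forall>y\<in>sob (Suc m). \<Phi> y = (\<Sum>i\<le>m. integral {0..1} (\<lambda>x. \<omega> i x * (L1_deriv ^^ i) y x))"
    unfolding L1_functional_def by (elim exE conjE)
  show thesis by (rule that[of \<omega>]) (use w in auto)
qed

lemma L1_functional_cong:
  "L1_functional m \<Phi> \<Longrightarrow> (\<And>y. y \<in> sob (Suc m) \<Longrightarrow> \<Psi> y = \<Phi> y) \<Longrightarrow> L1_functional m \<Psi>"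
  unfolding L1_functional_def by simp

lemma L1_mult_sob: "f \<in> L1 \<Longrightarrow> y \<in> sob (Suc m) \<Longrightarrow> i \<le> m \<Longrightarrow> (\<lambda>x. f x * (L1_deriv ^^ i) y x) \<in> L1"
  by (intro L1_mult_W11 sob_W11) auto

lemma L1_functional_basic:
  assumes \<sigma>: "\<sigma> \<in> L1" and k: "k \<le> m"
  shows "L1_functional m (\<lambda>y. integral {0..1} (\<lambda>x. \<sigma> x * (L1_deriv ^^ k) y x))"
  unfolding L1_functional_def
proof (intro exI conjI ballI allI impI)
  let ?\<omega> = "\<lambda>i x. if i = k then \<sigma> x else 0"
  show "?\<omega> i \<in> L1" for i using \<sigma> L1_const[of 0] by (cases "i = k") auto
  fix y assume "y \<in> sob (Suc m)"
  have "(\<Sum>i\<le>m. integral {0..1} (\<lambda>x. ?\<omega> i x * (L1_deriv ^^ i) y x))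
    = (\<Sum>i\<le>m. if i = k then integral {0..1} (\<lambda>x. \<sigma> x * (L1_deriv ^^ k) y x) else 0)"
    by (rule sum.cong) auto
  then show "integral {0..1} (\<lambda>x. \<sigma> x * (L1_deriv ^^ k) y x)
    = (\<Sum>i\<le>m. integral {0..1} (\<lambda>x. ?\<omega> i x * (L1_deriv ^^ i) y x))"
    using k by simp
qed

lemma L1_functional_add:
  assumes "L1_functional m \<Phi>" "L1_functional m \<Psi>"
  shows "L1_functional m (\<lambda>y. \<Phi> y + \<Psi> y)"
proof -
  obtain \<omega> where w1: "\<And>i. i \<le> m \<Longrightarrow> \<omega> i \<in> L1"
    and eq1: "\<And>y. y \<in> sob (Suc m) \<Longrightarrow> \<Phi> y = (\<Sum>i\<le>m. integral {0..1} (\<lambda>x. \<omega> i x * (L1_deriv ^^ i) y x))"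
    by (rule L1_functionalE[OF assms(1)], rule that)
  obtain \<xi> where w2: "\<And>i. i \<le> m \<Longrightarrow> \<xi> i \<in> L1"
    and eq2: "\<And>y. y \<in> sob (Suc m) \<Longrightarrow> \<Psi> y = (\<Sum>i\<le>m. integral {0..1} (\<lambda>x. \<xi> i x * (L1_deriv ^^ i) y x))"
    by (rule L1_functionalE[OF assms(2)], rule that)
  show ?thesis unfolding L1_functional_def
  proof (intro exI[of _ "\<lambda>i x. \<omega> i x + \<xi> i x"] conjI ballI allI impI)
    show "(\<lambda>x. \<omega> i x + \<xi> i x) \<in> L1" if "i \<le> m" for i using that by (intro L1_add w1 w2)
    fix y assume y: "y \<in> sob (Suc m)"
    have "integral {0..1} (\<lambda>x. (\<omega> i x + \<xi> i x) * (L1_deriv ^^ i) y x) =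
       integral {0..1} (\<lambda>x. \<omega> i x * (L1_deriv ^^ i) y x) + integral {0..1} (\<lambda>x. \<xi> i x * (L1_deriv ^^ i) y x)"
      if "i \<le> m" for i
      unfolding distrib_right by (intro integral_add L1_integrable L1_mult_sob[OF _ y] w1 w2 that)
    then show "\<Phi> y + \<Psi> y = (\<Sum>i\<le>m. integral {0..1} (\<lambda>x. (\<omega> i x + \<xi> i x) * (L1_deriv ^^ i) y x))"
      by (simp add: eq1 eq2 y sum.distrib)
  qed
qed

lemma L1_functional_cmult:
  assumes "L1_functional m \<Phi>" shows "L1_functional m (\<lambda>y. c * \<Phi> y)"
proof -
  obtain \<omega> where w: "\<And>i. i \<le> m \<Longrightarrow> \<omega> i \<in> L1"
    and eq: "\<And>y. y \<in> sob (Suc m) \<Longrightarrow> \<Phi> y = (\<Sum>i\<le>m. integral {0..1} (\<lambda>x. \<omega> i x * (L1_deriv ^^ i) y x))"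
    by (rule L1_functionalE[OF assms], rule that)
  show ?thesis unfolding L1_functional_def
    by (rule exI[of _ "\<lambda>i x. c * \<omega> i x"]) (simp add: w L1_cmult eq mult.assoc sum_distrib_left)
qed

lemma L1_functional_zero: "L1_functional m (\<lambda>y. 0)"
  using L1_functional_cmult[OF L1_functional_basic[OF L1_const[of 0] le0], of m 0] by simp

lemma L1_functional_sum:
  "(\<And>i. i \<in> A \<Longrightarrow> L1_functional m (\<Phi> i)) \<Longrightarrow> L1_functional m (\<lambda>y. \<Sum>i\<in>A. \<Phi> i y)"
  by (induction A rule: infinite_finite_induct) (auto simp: L1_functional_zero intro: L1_functional_add)

text \<open>By the Leibniz formula only derivatives of \<open>y\<close> of orders k to k + i occur,
  with test functions as coefficients. These are absorbed into the L_1 function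
  \<open>\<sigma>\<close>.\<close>

lemma L1_functional_distr_mult:
  assumes \<tau>: "\<tau> \<in> W1_neg i" and k: "k + i \<le> m" and z: "z \<in> test_funs"
  shows "L1_functional m (\<lambda>y. distr_mult i \<tau> ((L1_deriv ^^ k) y) z)"
proof -
  \<comment> \<open>The same choice as inside \<open>distr_mult\<close>. It depends on
    \<open>i\<close> and \<open>\<tau>\<close> alone, so the weights do not vary with
    \<open>y\<close>.\<close>
  define \<sigma> where "\<sigma> = (SOME \<sigma>. \<sigma> \<in> L1 \<and> \<tau> \<doteq> (distr_deriv ^^ i) (distr_of \<sigma>))"
  have "\<exists>\<sigma>. \<sigma> \<in> L1 \<and> \<tau> \<doteq> (distr_deriv ^^ i) (distr_of \<sigma>)"
    using \<tau> unfolding W1_neg_def by blast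
  from someI_ex[OF this] have \<sigma>: "\<sigma> \<in> L1" unfolding \<sigma>_def by blast
  from leibniz_test_funs[OF z, of i] obtain \<zeta> where "\<forall>l\<le>i. \<zeta> l \<in> test_funs" and "\<forall>g\<in>sob i.
      (L1_deriv ^^ i) (\<lambda>t. g t * z t) \<simeq> (\<lambda>x. \<Sum>l\<le>i. (L1_deriv ^^ l) g x * \<zeta> l x)"
    by (elim exE conjE)
  note \<zeta> = this(1)[rule_format] and leibniz = this(2)[rule_format]
  have L: "(\<lambda>x. \<sigma> x * \<zeta> l x) \<in> L1" if "l \<le> i" for l
    by (intro L1_mult_test_funs \<sigma> \<zeta> that)
  have rep: "L1_functional m (\<lambda>y. (-1) ^ i *
      (\<Sum>l\<le>i. integral {0..1} (\<lambda>x. (\<sigma> x * \<zeta> l x) * (L1_deriv ^^ (l + k)) y x)))"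
    using k by (intro L1_functional_cmult L1_functional_sum L1_functional_basic L) auto
  show ?thesis
  proof (rule L1_functional_cong[OF rep])
    fix y assume y: "y \<in> sob (Suc m)"
    have "(L1_deriv ^^ k) y \<in> sob i" using k by (intro sob_funpow sob_mono[OF y]) simp
    from leibniz[OF this]
    have "(\<lambda>x. \<sigma> x * (L1_deriv ^^ i) (\<lambda>t. (L1_deriv ^^ k) y t * z t) x) \<simeq>
        (\<lambda>x. \<Sum>l\<le>i. (\<sigma> x * \<zeta> l x) * (L1_deriv ^^ (l + k)) y x)"
      by (rule ae_eq_mono) (simp add: funpow_add sum_distrib_left mult_ac)
    from integral_cong_ae_eq[OF this]
    have "integral {0..1} (\<lambda>x. \<sigma> x * (L1_deriv ^^ i) (\<lambda>t. (L1_deriv ^^ k) y t * z t) x) =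
        integral {0..1} (\<lambda>x. \<Sum>l\<le>i. (\<sigma> x * \<zeta> l x) * (L1_deriv ^^ (l + k)) y x)" .
    also have "\<dots> = (\<Sum>l\<le>i. integral {0..1} (\<lambda>x. (\<sigma> x * \<zeta> l x) * (L1_deriv ^^ (l + k)) y x))"
      using k by (intro integral_sum L1_integrable L1_mult_sob[OF L y]) auto
    finally show "distr_mult i \<tau> ((L1_deriv ^^ k) y) z = (-1) ^ i *
      (\<Sum>l\<le>i. integral {0..1} (\<lambda>x. (\<sigma> x * \<zeta> l x) * (L1_deriv ^^ (l + k)) y x))"
      unfolding distr_mult_def Let_def \<sigma>_def[symmetric] by simp
  qed
qed

text \<open>The singularity orders fit exactly: once the outer derivatives are moved to
  \<open>z\<close>, the order left on \<open>y\<close> is at most k + (m - k) = m in the even terms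
  and (k + 1) + (m - k - 1) = m in the odd ones. In the leading term all derivatives go to
  \<open>z\<close>.\<close>

lemma L1_functional_diff_expr:
  assumes \<tau>: "\<tau> \<in> coeff_space m" and z: "z \<in> test_funs"
  shows "L1_functional m (\<lambda>y. diff_expr m \<tau> y z)"
proof -
  have \<tau>': "\<tau> \<nu> \<in> W1_neg (sing_order m \<nu>)" if "\<nu> < 2 * m + 1" for \<nu>
    using \<tau> that unfolding coeff_space_def by blast
  note zk = test_funs_funpow_cderiv[OF z]
  have 1: "L1_functional m (\<lambda>y. (-1) ^ (2 * m + 1) *
      integral {0..1} (\<lambda>x. (cderiv ^^ (2 * m + 1)) z x * (L1_deriv ^^ 0) y x))"
    by (intro L1_functional_cmult L1_functional_basic L1_continuous test_funs_continuous_on zk) simp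
  have 2: "L1_functional m (\<lambda>y. \<Sum>k\<le>m. (-1) ^ k * ((-1) ^ k *
     distr_mult (sing_order m (2 * k)) (\<tau> (2 * k)) ((L1_deriv ^^ k) y) ((cderiv ^^ k) z)))"
    by (intro L1_functional_sum L1_functional_cmult L1_functional_distr_mult \<tau>' zk) (auto simp: sing_order_def)
  have 3: "L1_functional m (\<lambda>y. \<Sum>k<m. (-1) ^ (k + 1) *
     ((-1) ^ (k + 1) * distr_mult (sing_order m (2 * k + 1)) (\<tau> (2 * k + 1)) ((L1_deriv ^^ k) y) ((cderiv ^^ (k + 1)) z)
    + (-1) ^ k * distr_mult (sing_order m (2 * k + 1)) (\<tau> (2 * k + 1)) ((L1_deriv ^^ (k + 1)) y) ((cderiv ^^ k) z)))"
    by (intro L1_functional_sum L1_functional_cmult L1_functional_add L1_functional_distr_mult \<tau>' zk)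
      (auto simp: sing_order_def)
  have 0: "distr_of y w = integral {0..1} (\<lambda>x. w x * (L1_deriv ^^ 0) y x)" for y w
    unfolding distr_of_def by (simp add: mult.commute)
  show ?thesis
    using L1_functional_add[OF L1_functional_add[OF 1 2] 3]
    unfolding diff_expr_def funpow_distr_deriv 0 .
qed

section \<open>Quasi-derivatives as distributions\<close>

text \<open>Written with derivatives of \<open>y\<close> instead of quasi-derivatives, so that it
  makes sense on all of W_1^{m+1}. The columns stop at m + 1, where y^{[j-1]} still equals
  y^{(j-1)}.\<close>

definition row_sum :: "nat \<Rightarrow> matrix_fun \<Rightarrow> (real \<Rightarrow> complex) \<Rightarrow> nat \<Rightarrow> real \<Rightarrow> complex" where
  "row_sum m F y k x = (if k \<le> m then 0 else \<Sum>j\<in>{1..m + 1}. F k j x * (L1_deriv ^^ (j - 1)) y x)"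

text \<open>For \<open>k = 2 * m + 1\<close> this is L_F(y). Outside the domain
  \<open>quasi_deriv\<close> would apply \<open>L1_deriv\<close> to functions without an L_1
  derivative and return unspecified values; distributional derivatives remain meaningful
  there.\<close>

fun quasi_distr :: "nat \<Rightarrow> matrix_fun \<Rightarrow> (real \<Rightarrow> complex) \<Rightarrow> nat \<Rightarrow> distr" where
  "quasi_distr m F y 0 = distr_of y"
| "quasi_distr m F y (Suc k) = (\<lambda>z. distr_deriv (quasi_distr m F y k) z - distr_of (row_sum m F y (Suc k)) z)"

lemma row_sum_L1:
  assumes F: "F \<in> matrix_class m" and y: "y \<in> sob (Suc m)" and k: "k \<le> 2 * m + 1"
  shows "row_sum m F y k \<in> L1"
proof (cases "k \<le> m")
  case True
  then have "row_sum m F y k = (\<lambda>x. 0)" by (simp add: row_sum_def[abs_def])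
  then show ?thesis by (simp add: L1_const)
next
  case False
  then have "row_sum m F y k = (\<lambda>x. \<Sum>j\<in>{1..m + 1}. F k j x * (L1_deriv ^^ (j - 1)) y x)"
    by (simp add: row_sum_def[abs_def])
  moreover have "F k j \<in> L1" if "j \<in> {1..m + 1}" for j
    using F False k that unfolding matrix_class_def by auto
  ultimately show ?thesis by (auto intro!: L1_sum L1_mult_sob[OF _ y] simp del: sum.cl_ivl_Suc)
qed

lemma linear_quasi_distr:
  assumes "F \<in> matrix_class m" "y \<in> sob (Suc m)"
  shows "k \<le> 2 * m + 1 \<Longrightarrow> linear_distr (quasi_distr m F y k)"
proof (induction k)
  case 0
  then show ?case using sob_L1[OF assms(2), of 0] by (simp add: linear_distr_of)
next
  case (Suc k)
  then show ?case
    using linear_distr_diff[OF linear_distr_deriv linear_distr_of[OF row_sum_L1[OF assms]]] by simp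
qed

lemma L1_functional_row_sum:
  assumes F: "F \<in> matrix_class m" and k: "k \<le> 2 * m + 1" and z: "z \<in> test_funs"
  shows "L1_functional m (\<lambda>y. distr_of (row_sum m F y k) z)"
proof (cases "k \<le> m")
  case True
  then show ?thesis by (simp add: row_sum_def[abs_def] distr_of_def L1_functional_zero)
next
  case False
  have FL: "(\<lambda>x. F k j x * z x) \<in> L1" if "j \<in> {1..m + 1}" for j
    using F False k that unfolding matrix_class_def by (intro L1_mult_test_funs z) auto
  have "L1_functional m (\<lambda>y. \<Sum>j\<in>{1..m + 1}. integral {0..1} (\<lambda>x. (F k j x * z x) * (L1_deriv ^^ (j - 1)) y x))"
    by (intro L1_functional_sum L1_functional_basic FL) auto
  then show ?thesis
  proof (rule L1_functional_cong)
    fix y assume y: "y \<in> sob (Suc m)"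
    have "distr_of (row_sum m F y k) z
       = integral {0..1} (\<lambda>x. \<Sum>j\<in>{1..m + 1}. (F k j x * z x) * (L1_deriv ^^ (j - 1)) y x)"
      unfolding distr_of_def row_sum_def if_not_P[OF False] sum_distrib_right by (simp only: mult_ac)
    also have "\<dots> = (\<Sum>j\<in>{1..m + 1}. integral {0..1} (\<lambda>x. (F k j x * z x) * (L1_deriv ^^ (j - 1)) y x))"
      by (intro integral_sum L1_integrable L1_mult_sob[OF FL y]) auto
    finally show "distr_of (row_sum m F y k) z = \<dots>" .
  qed
qed

lemma L1_functional_quasi_distr:
  assumes F: "F \<in> matrix_class m"
  shows "k \<le> 2 * m + 1 \<Longrightarrow> z \<in> test_funs \<Longrightarrow> L1_functional m (\<lambda>y. quasi_distr m F y k z)"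
proof (induction k arbitrary: z)
  case 0
  have "L1_functional m (\<lambda>y. integral {0..1} (\<lambda>x. z x * (L1_deriv ^^ 0) y x))"
    by (intro L1_functional_basic L1_continuous test_funs_continuous_on 0) simp
  then show ?case by (simp add: distr_of_def mult.commute)
next
  case (Suc k)
  have "L1_functional m (\<lambda>y. (-1) * quasi_distr m F y k (cderiv z) + (-1) * distr_of (row_sum m F y (Suc k)) z)"
    using Suc.prems by (intro L1_functional_add L1_functional_cmult Suc.IH L1_functional_row_sum F test_funs_cderiv) auto
  then show ?case by (simp add: distr_deriv_def)
qed

text \<open>Admitting an equivalent function \<open>r\<close> lets explicit formulas replace
  \<open>row_sum\<close>, which contains chosen representatives.\<close>

lemma quasi_distr_Suc:
  assumes f: "quasi_distr m F y k \<doteq> distr_of f" and g: "has_L1_deriv f g"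
    and R: "row_sum m F y (Suc k) \<simeq> r" and r: "r \<in> L1"
  shows "quasi_distr m F y (Suc k) \<doteq> distr_of (\<lambda>x. g x - r x)"
  unfolding distr_eq_def
proof
  fix z assume z: "z \<in> test_funs"
  have "distr_deriv (quasi_distr m F y k) z = distr_deriv (distr_of f) z"
    using f test_funs_cderiv[OF z] unfolding distr_eq_def distr_deriv_def by simp
  also have "\<dots> = distr_of g z"
    using g z unfolding has_L1_deriv_def distr_eq_def by blast
  finally show "quasi_distr m F y (Suc k) z = distr_of (\<lambda>x. g x - r x) z"
    unfolding distr_of_diff[OF has_L1_deriv_L1[OF g] r z] by (simp add: distr_of_cong[OF R])
qed

lemma quasi_deriv_eq_funpow:
  assumes F: "F \<in> matrix_class m"
  shows "k \<le> m \<Longrightarrow> x \<in> {0..1} \<Longrightarrow> quasi_deriv F y k x = (L1_deriv ^^ k) y x"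
proof (induction k arbitrary: x)
  case (Suc k)
  have "L1_deriv (quasi_deriv F y k) = L1_deriv ((L1_deriv ^^ k) y)"
    by (intro L1_deriv_cong ae_eqI Suc.IH) (use Suc.prems in auto)
  moreover have "F (Suc k) j x = 0" if "j \<in> {1..Suc k}" for j
    using F Suc.prems that unfolding matrix_class_def by auto
  ultimately show ?case by simp
qed simp

lemma quasi_deriv_Suc_eq:
  assumes F: "F \<in> matrix_class m" and k: "k \<le> 2 * m" and x: "x \<in> {0..1}"
  shows "quasi_deriv F y (Suc k) x = L1_deriv (quasi_deriv F y k) x - row_sum m F y (Suc k) x"
proof (cases "Suc k \<le> m")
  case True
  have "F (Suc k) j x = 0" if "j \<in> {1..Suc k}" for j
    using F True that x unfolding matrix_class_def by auto
  then show ?thesis using True by (simp add: row_sum_def)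
next
  case False
  have "(\<Sum>j\<in>{1..Suc k}. F (Suc k) j x * quasi_deriv F y (j - 1) x)
    = (\<Sum>j\<in>{1..m + 1}. F (Suc k) j x * (L1_deriv ^^ (j - 1)) y x)"
  \<comment> \<open>Row k + 1 exceeds m here, so the range on the left contains the columns 1 to m +
    1; the entries in the later columns vanish.\<close>
  proof (rule sum.mono_neutral_cong_right)
    show "\<forall>j\<in>{1..Suc k} - {1..m + 1}. F (Suc k) j x * quasi_deriv F y (j - 1) x = 0"
    proof
      fix j assume "j \<in> {1..Suc k} - {1..m + 1}"
      then have "F (Suc k) j x = 0" using F k x unfolding matrix_class_def by auto
      then show "F (Suc k) j x * quasi_deriv F y (j - 1) x = 0" by simp
    qed
    show "F (Suc k) j x * quasi_deriv F y (j - 1) x = F (Suc k) j x * (L1_deriv ^^ (j - 1)) y x"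
      if "j \<in> {1..m + 1}" for j
      using quasi_deriv_eq_funpow[OF F _ x, of "j - 1"] that by auto
  qed (use False in auto)
  then show ?thesis using False by (simp only: quasi_deriv.simps row_sum_def if_False)
qed

lemma quasi_deriv_Suc_L1:
  assumes F: "F \<in> matrix_class m" and k: "k \<le> 2 * m" and y: "y \<in> sob (Suc m)"
    and W: "quasi_deriv F y k \<in> W11"
  shows "quasi_deriv F y (Suc k) \<in> L1"
    and "quasi_distr m F y k \<doteq> distr_of (quasi_deriv F y k) \<Longrightarrow>
      quasi_distr m F y (Suc k) \<doteq> distr_of (quasi_deriv F y (Suc k))"
proof -
  have R: "row_sum m F y (Suc k) \<in> L1" using k by (intro row_sum_L1 F y) simp
  have ae: "(\<lambda>x. L1_deriv (quasi_deriv F y k) x - row_sum m F y (Suc k) x) \<simeq> quasi_deriv F y (Suc k)"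
    by (intro ae_eqI) (simp only: quasi_deriv_Suc_eq[OF F k])
  show "quasi_deriv F y (Suc k) \<in> L1"
    by (rule L1_cong_ae_eq[OF ae]) (intro L1_diff L1_deriv_L1 W R)
  assume "quasi_distr m F y k \<doteq> distr_of (quasi_deriv F y k)"
  from quasi_distr_Suc[OF this has_L1_deriv_L1_deriv[OF W] ae_eq_refl R]
  show "quasi_distr m F y (Suc k) \<doteq> distr_of (quasi_deriv F y (Suc k))"
    unfolding distr_of_cong[OF ae] .
qed

lemma quasi_domain_sob:
  assumes F: "F \<in> matrix_class m" and y: "y \<in> quasi_domain m F"
  shows "y \<in> sob (Suc m)"
proof -
  have W: "quasi_deriv F y k \<in> W11" if "k < 2 * m + 1" for k
    using y that unfolding quasi_domain_def by blast
  have "(L1_deriv ^^ i) y \<in> W11" if "i < Suc m" for i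
  proof (rule W11_cong)
    show "quasi_deriv F y i \<simeq> (L1_deriv ^^ i) y"
      using that by (intro ae_eqI quasi_deriv_eq_funpow[OF F]) auto
    show "quasi_deriv F y i \<in> W11" using W that by simp
  qed
  then show ?thesis using W11_L1[OF W[of 0]] unfolding sob_def by simp
qed

lemma quasi_domain_imp:
  assumes F: "F \<in> matrix_class m" and y: "y \<in> quasi_domain m F"
  shows "quasi_deriv F y (2 * m + 1) \<in> L1"
    and "quasi_distr m F y (2 * m + 1) \<doteq> distr_of (quasi_deriv F y (2 * m + 1))"
proof -
  note s = quasi_domain_sob[OF F y]
  have W: "quasi_deriv F y k \<in> W11" if "k \<le> 2 * m" for k
    using y that unfolding quasi_domain_def by auto
  show "quasi_deriv F y (2 * m + 1) \<in> L1"
    using quasi_deriv_Suc_L1(1)[OF F _ s W] by simp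
  have "quasi_distr m F y k \<doteq> distr_of (quasi_deriv F y k)" if "k \<le> 2 * m + 1" for k
    using that
  proof (induction k)
    case (Suc k)
    then show ?case using quasi_deriv_Suc_L1(2)[OF F _ s W] by simp
  qed (simp add: distr_eq_def)
  then show "quasi_distr m F y (2 * m + 1) \<doteq> distr_of (quasi_deriv F y (2 * m + 1))" by blast
qed

text \<open>Going down from the top, each step adds an L_1 row sum and integrates, so every lower
  quasi-derivative is an L_1 function as a distribution. But \<open>quasi_deriv\<close> is built
  from below by choices; a second induction goes up and identifies it with these
  distributions.\<close>

lemma quasi_domainI:
  assumes F: "F \<in> matrix_class m" and y: "y \<in> sob (Suc m)"
    and g: "g \<in> L1" "quasi_distr m F y (2 * m + 1) \<doteq> distr_of g"
  shows "y \<in> quasi_domain m F"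
proof -
  have down: "\<exists>h\<in>L1. quasi_distr m F y (2 * m + 1 - i) \<doteq> distr_of h" if "i \<le> 2 * m + 1" for i
    using that
  proof (induction i)
    case 0
    then show ?case using g by auto
  next
    case (Suc i)
    define k where "k = 2 * m + 1 - Suc i"
    have k: "Suc k = 2 * m + 1 - i" "k \<le> 2 * m" using Suc.prems by (auto simp: k_def)
    obtain h where h: "h \<in> L1" "quasi_distr m F y (Suc k) \<doteq> distr_of h" using Suc k by auto
    have R: "row_sum m F y (Suc k) \<in> L1" using k by (intro row_sum_L1 F y) simp
    have L: "(\<lambda>x. h x + row_sum m F y (Suc k) x) \<in> L1" by (intro L1_add h R)
    have "distr_deriv (quasi_distr m F y k) \<doteq> distr_of (\<lambda>x. h x + row_sum m F y (Suc k) x)"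
      unfolding distr_eq_def
    proof
      fix z assume z: "z \<in> test_funs"
      then have "quasi_distr m F y (Suc k) z = distr_of h z" using h(2) unfolding distr_eq_def by blast
      then show "distr_deriv (quasi_distr m F y k) z = distr_of (\<lambda>x. h x + row_sum m F y (Suc k) x) z"
        unfolding distr_of_add[OF h(1) R z] by (simp add: algebra_simps)
    qed
    from distr_primitive[OF linear_quasi_distr[OF F y] L this] k(2)
    obtain c where "quasi_distr m F y k \<doteq> distr_of (\<lambda>x. c + prim (\<lambda>x. h x + row_sum m F y (Suc k) x) x)"
      by auto
    then show ?case using L1_const_plus_prim[OF L] unfolding k_def by blast
  qed
  have down': "\<exists>h\<in>L1. quasi_distr m F y k \<doteq> distr_of h" if "k \<le> 2 * m + 1" for k
    using down[of "2 * m + 1 - k"] that by (simp only: diff_diff_cancel diff_le_self)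
  have up: "quasi_deriv F y k \<in> L1 \<and> quasi_distr m F y k \<doteq> distr_of (quasi_deriv F y k) \<and>
      (k < 2 * m + 1 \<longrightarrow> quasi_deriv F y k \<in> W11)" if "k \<le> 2 * m + 1" for k
    using that
  proof (induction k)
    case 0
    have "y \<in> W11" using sob_W11[OF y, of 0] by simp
    then show ?case by (simp add: W11_L1 distr_eq_def)
  next
    case (Suc k)
    then have W: "quasi_deriv F y k \<in> W11" and d: "quasi_distr m F y k \<doteq> distr_of (quasi_deriv F y k)"
      and k: "k \<le> 2 * m" by auto
    note L = quasi_deriv_Suc_L1(1)[OF F k y W]
    note D = quasi_deriv_Suc_L1(2)[OF F k y W d]
    have "quasi_deriv F y (Suc k) \<in> W11" if k: "Suc k < 2 * m + 1"
    proof -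
      \<comment> \<open>The function found on the way down at index k + 2, plus the row sum there,
        is the derivative that \<open>quasi_deriv F y (Suc k)\<close> must have.\<close>
      obtain h where h: "h \<in> L1" "quasi_distr m F y (Suc (Suc k)) \<doteq> distr_of h"
        using down'[OF Suc_leI[OF k]] by blast
      have R: "row_sum m F y (Suc (Suc k)) \<in> L1" using k by (intro row_sum_L1 F y) simp
      have "has_L1_deriv (quasi_deriv F y (Suc k)) (\<lambda>x. h x + row_sum m F y (Suc (Suc k)) x)"
        unfolding has_L1_deriv_def distr_eq_def
      proof (intro conjI ballI L1_add h R)
        fix z assume z: "z \<in> test_funs"
        have "quasi_distr m F y (Suc (Suc k)) z = distr_of h z" using h(2) z unfolding distr_eq_def by blast
        moreover have "distr_deriv (quasi_distr m F y (Suc k)) z = distr_deriv (distr_of (quasi_deriv F y (Suc k))) z"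
          using D test_funs_cderiv[OF z] unfolding distr_eq_def distr_deriv_def by simp
        ultimately show "distr_deriv (distr_of (quasi_deriv F y (Suc k))) z
            = distr_of (\<lambda>x. h x + row_sum m F y (Suc (Suc k)) x) z"
          unfolding distr_of_add[OF h(1) R z] by (simp add: algebra_simps del: quasi_deriv.simps)
      qed
      then show ?thesis by (rule W11I[OF L])
    qed
    then show ?case using L D by blast
  qed
  show ?thesis unfolding quasi_domain_def using up by auto
qed

section \<open>Volterra equations\<close>

text \<open>Split \<open>a\<close> into a polynomial \<open>p\<close> and a remainder small in L_1.
  As the weight increases, the remainder contributes at most (\<delta>/2) exp(Ct); the polynomial,
  bounded by B, contributes at most (B/C) exp(Ct).\<close>

lemma exp_weight:
  fixes a :: "real \<Rightarrow> complex"
  assumes a: "a \<in> L1" and d: "\<delta> > 0"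
  obtains C where "C \<ge> 0" "\<And>t. t \<in> {0..1} \<Longrightarrow> integral {0..t} (\<lambda>s. norm (a s) * exp (C * s)) \<le> \<delta> * exp (C * t)"
proof -
  obtain p where p: "polynomial_function p" and pa: "integral {0..1} (\<lambda>x. norm (p x - a x)) < \<delta> / 2"
    using L1_polynomial_approx[OF a, of "\<delta> / 2"] d by auto
  have pc: "continuous_on {0..1} p" by (rule continuous_polynomial_function[OF p])
  obtain B where B: "B > 0" "\<And>x. x \<in> {0..1} \<Longrightarrow> norm (p x) \<le> B"
    using bounded_on_unit[OF pc] by metis
  \<comment> \<open>Chosen to make B / C equal to \<delta> / 2.\<close>
  define C where "C = 2 * B / \<delta>"
  have C: "C > 0" using B(1) d by (simp add: C_def)
  have pL: "p \<in> L1" by (rule L1_continuous[OF pc])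
  have *: "integral {0..t} (\<lambda>s. norm (a s) * exp (C * s)) \<le> \<delta> * exp (C * t)" if t: "t \<in> {0..1}" for t
  proof -
    have eL: "(\<lambda>s. f s * complex_of_real (exp (C * s))) \<in> L1" if "f \<in> L1" for f
      by (rule L1_mult_continuous[OF that]) (intro continuous_intros)
    have i1: "(\<lambda>s. norm (a s) * exp (C * s)) integrable_on {0..t}"
      using L1_norm_integrable_sub[OF eL[OF a] t] by (simp add: norm_mult)
    have i2: "(\<lambda>s. norm (p s - a s)) integrable_on {0..t}"
      by (rule L1_norm_integrable_sub[OF L1_diff[OF pL a] t])
    have hi: "((\<lambda>s. exp (C * s)) has_integral (exp (C * t) / C - exp (C * 0) / C)) {0..t}"
    proof (rule fundamental_theorem_of_calculus)
      fix x
      have "((\<lambda>s. exp (C * s) / C) has_real_derivative exp (C * x)) (at x within {0..t})"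
        using C by (auto intro!: derivative_eq_intros)
      then show "((\<lambda>s. exp (C * s) / C) has_vector_derivative exp (C * x)) (at x within {0..t})"
        by (simp add: has_real_derivative_iff_has_vector_derivative)
    qed (use t in simp)
    have i3: "(\<lambda>s. exp (C * s)) integrable_on {0..t}" using hi by blast
    have "integral {0..t} (\<lambda>s. norm (a s) * exp (C * s))
        \<le> integral {0..t} (\<lambda>s. exp (C * t) * norm (p s - a s) + B * exp (C * s))"
    proof (rule integral_le[OF i1])
      show "(\<lambda>s. exp (C * t) * norm (p s - a s) + B * exp (C * s)) integrable_on {0..t}"
        by (intro integrable_add integrable_on_mult_right i2 i3)
      fix s assume s: "s \<in> {0..t}"
      have "norm (a s) \<le> norm (p s - a s) + B"
        using B(2)[of s] s t norm_triangle_ineq4[of "p s" "p s - a s"] by simp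
      then have "norm (a s) * exp (C * s) \<le> (norm (p s - a s) + B) * exp (C * s)"
        by (rule mult_right_mono) simp
      also have "\<dots> = norm (p s - a s) * exp (C * s) + B * exp (C * s)"
        by (simp add: distrib_right)
      also have "norm (p s - a s) * exp (C * s) \<le> norm (p s - a s) * exp (C * t)"
        using s C by (intro mult_left_mono) auto
      finally show "norm (a s) * exp (C * s) \<le> exp (C * t) * norm (p s - a s) + B * exp (C * s)"
        by (simp add: mult.commute)
    qed
    also have "\<dots> = exp (C * t) * integral {0..t} (\<lambda>s. norm (p s - a s)) + B * integral {0..t} (\<lambda>s. exp (C * s))"
      by (subst integral_add) (auto intro!: integrable_on_mult_right i2 i3)
    also have "integral {0..t} (\<lambda>s. exp (C * s)) \<le> exp (C * t) / C"
      using integral_unique[OF hi] C by simp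
    also have "integral {0..t} (\<lambda>s. norm (p s - a s)) \<le> integral {0..1} (\<lambda>s. norm (p s - a s))"
      using t by (intro integral_subset_le i2 L1_norm_integrable L1_diff pL a) auto
    also note pa
    also have "exp (C * t) * (\<delta> / 2) + B * (exp (C * t) / C) = \<delta> * exp (C * t)"
      using B(1) d by (simp add: C_def field_simps)
    finally show ?thesis using B(1) by simp
  qed
  show thesis by (rule that[OF less_imp_le[OF C] *])
qed

text \<open>The exponential weight makes \<open>K\<close> a contraction, so the Neumann series converges.\<close>

lemma volterra_solution:
  fixes K :: "(real \<Rightarrow> complex) \<Rightarrow> real \<Rightarrow> complex"
  assumes C: "C \<ge> 0"
    and cont: "\<And>w. continuous_on {0..1} w \<Longrightarrow> continuous_on {0..1} (K w)"
    and diff: "\<And>u v x. continuous_on {0..1} u \<Longrightarrow> continuous_on {0..1} v \<Longrightarrow> x \<in> {0..1} \<Longrightarrow>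
        K (\<lambda>x. u x - v x) x = K u x - K v x"
    and bound: "\<And>w B x. continuous_on {0..1} w \<Longrightarrow> B \<ge> 0 \<Longrightarrow>
        (\<And>x. x \<in> {0..1} \<Longrightarrow> norm (w x) \<le> B * exp (C * x)) \<Longrightarrow> x \<in> {0..1} \<Longrightarrow> norm (K w x) \<le> B / 2 * exp (C * x)"
    and h: "continuous_on {0..1} h" and e: "e \<ge> 0" and he: "\<And>x. x \<in> {0..1} \<Longrightarrow> norm (h x) \<le> e"
  obtains w where "continuous_on {0..1} w" "\<And>x. x \<in> {0..1} \<Longrightarrow> w x = h x + K w x"
    "\<And>x. x \<in> {0..1} \<Longrightarrow> norm (w x) \<le> 2 * e * exp C"
proof -
  define W where "W = rec_nat h (\<lambda>n w x. h x + K w x)"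
  have W0: "W 0 = h" and WS: "W (Suc n) = (\<lambda>x. h x + K (W n) x)" for n
    by (simp_all add: W_def)
  have Wc: "continuous_on {0..1} (W n)" for n
    by (induction n) (auto simp: W0 WS h intro!: continuous_intros cont)
  have exp1: "1 \<le> exp (C * x)" if "x \<in> {0..1}" for x
    using C that by simp
  have expC: "exp (C * x) \<le> exp C" if "x \<in> {0..1}" for x
    using C that by (simp add: mult_left_le)
  have he': "norm (h x) \<le> e * exp (C * x)" if "x \<in> {0..1}" for x
    using he[OF that] mult_left_mono[OF exp1[OF that] e] by simp
  \<comment> \<open>The constant \<open>2 * e\<close> reproduces itself: \<open>K\<close> halves it,
    and adding the bound \<open>e\<close> of \<open>h\<close> restores it.\<close>
  have Wb: "norm (W n x) \<le> 2 * e * exp (C * x)" if "x \<in> {0..1}" for n x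
    using that
  proof (induction n arbitrary: x)
    case 0
    have "0 \<le> e * exp (C * x)" using e by simp
    then show ?case using he'[OF 0] by (simp add: W0)
  next
    case (Suc n)
    have "norm (K (W n) x) \<le> 2 * e / 2 * exp (C * x)"
      by (rule bound[OF Wc _ Suc.IH Suc.prems]) (use e in auto)
    then show ?case
      using he'[OF Suc.prems] norm_triangle_ineq[of "h x" "K (W n) x"] by (simp add: WS)
  qed
  define D where "D n x = W (Suc n) x - W n x" for n x
  have Dc: "continuous_on {0..1} (D n)" for n
    unfolding D_def by (intro continuous_intros Wc)
  \<comment> \<open>Each difference of iterates is \<open>K\<close> applied to the preceding one,
    which halves the weighted bound.\<close>
  have Db: "norm (D n x) \<le> e * (1 / 2) ^ n * exp (C * x)" if "x \<in> {0..1}" for n x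
    using that
  proof (induction n arbitrary: x)
    case 0
    have "norm (K h x) \<le> e / 2 * exp (C * x)" by (rule bound[OF h e he' 0])
    moreover have "e / 2 * exp (C * x) \<le> e * exp (C * x)" using e by (intro mult_right_mono) auto
    ultimately show ?case by (simp add: D_def WS W0)
  next
    case (Suc n)
    have "D (Suc n) x = K (W (Suc n)) x - K (W n) x"
      unfolding D_def WS[of "Suc n"] WS[of n] by simp
    also have "\<dots> = K (D n) x" unfolding D_def by (rule diff[OF Wc Wc Suc.prems, symmetric])
    finally show ?case using bound[OF Dc _ Suc.IH Suc.prems] e by simp
  qed
  define w where "w x = h x + (\<Sum>i. D i x)" for x
  have uD: "uniform_limit {0..1} (\<lambda>n x. \<Sum>i<n. D i x) (\<lambda>x. \<Sum>i. D i x) sequentially"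
  proof (rule Weierstrass_m_test)
    show "norm (D n x) \<le> e * exp C * (1 / 2) ^ n" if "x \<in> {0..1}" for n x
    proof -
      have "e * (1 / 2) ^ n * exp (C * x) \<le> e * (1 / 2) ^ n * exp C"
        using e expC[OF that] by (intro mult_left_mono) auto
      then show ?thesis using Db[OF that, of n] by (simp add: mult_ac)
    qed
    show "summable (\<lambda>n. e * exp C * (1 / 2) ^ n)"
      by (intro summable_mult summable_geometric) simp
  qed
  have tele: "W n x = h x + (\<Sum>i<n. D i x)" for n x
    by (induction n) (simp_all add: W0 D_def)
  have uW: "uniform_limit {0..1} W w sequentially"
  proof -
    have "uniform_limit {0..1} (\<lambda>n x. h x + (\<Sum>i<n. D i x)) (\<lambda>x. h x + (\<Sum>i. D i x)) sequentially"
      by (intro uniform_limit_intros uD)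
    moreover have "W = (\<lambda>n x. h x + (\<Sum>i<n. D i x))" "w = (\<lambda>x. h x + (\<Sum>i. D i x))"
      by (intro ext, simp add: tele, intro ext, simp add: w_def)
    ultimately show ?thesis by simp
  qed
  have wc: "continuous_on {0..1} w"
    by (rule uniform_limit_theorem[OF always_eventually uW]) (simp_all add: Wc)
  have lim: "(\<lambda>n. W n x) \<longlonglongrightarrow> w x" if "x \<in> {0..1}" for x
    by (rule tendsto_uniform_limitI[OF uW that])
  show thesis
  proof (rule that[OF wc])
    fix x :: real assume x: "x \<in> {0..1}"
    have "norm (w x) \<le> 2 * e * exp (C * x)"
      by (rule tendsto_upperbound[OF tendsto_norm[OF lim[OF x]]]) (simp_all add: Wb[OF x])
    also have "\<dots> \<le> 2 * e * exp C" using e expC[OF x] by (intro mult_left_mono) auto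
    finally show "norm (w x) \<le> 2 * e * exp C" .
    \<comment> \<open>The contraction bound, applied to the difference of \<open>W n\<close> and
      \<open>w\<close>, also carries the limit through \<open>K\<close>; the weight stays between 1
      and \<open>exp C\<close>.\<close>
    have "(\<lambda>n. K (W n) x) \<longlonglongrightarrow> K w x"
    proof (rule LIMSEQ_I)
      fix r :: real assume r: "r > 0"
      define d where "d = r / exp C"
      have d: "d > 0" using r by (simp add: d_def)
      obtain N where N: "\<And>n x. n \<ge> N \<Longrightarrow> x \<in> {0..1} \<Longrightarrow> dist (W n x) (w x) < d"
        using uniform_limitD[OF uW d] unfolding eventually_sequentially by blast
      have "norm (K (W n) x - K w x) < r" if "n \<ge> N" for n
      proof -
        have "norm (K (\<lambda>x. W n x - w x) x) \<le> d / 2 * exp (C * x)"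
        proof (rule bound[OF _ _ _ x])
          fix x :: real assume x: "x \<in> {0..1}"
          have "norm (W n x - w x) \<le> d" using N[OF that x] by (simp add: dist_norm)
          also have "\<dots> \<le> d * exp (C * x)" using mult_left_mono[OF exp1[OF x], of d] d by simp
          finally show "norm (W n x - w x) \<le> d * exp (C * x)" .
        qed (use d in \<open>auto intro!: continuous_intros Wc wc\<close>)
        also have "\<dots> \<le> d / 2 * exp C" using d expC[OF x] by (intro mult_left_mono) auto
        also have "\<dots> < r" using r by (simp add: d_def)
        finally show ?thesis unfolding diff[OF Wc wc x] .
      qed
      then show "\<exists>N. \<forall>n\<ge>N. norm (K (W n) x - K w x) < r" by blast
    qed
    then have "(\<lambda>n. W (Suc n) x) \<longlonglongrightarrow> h x + K w x"
      unfolding WS by (intro tendsto_intros)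
    then show "w x = h x + K w x" using LIMSEQ_unique[OF LIMSEQ_Suc[OF lim[OF x]]] by simp
  qed
qed

section \<open>Iterated primitives\<close>

lemma prim_funpow_L1: "u \<in> L1 \<Longrightarrow> (prim ^^ j) u \<in> L1"
  by (induction j) (auto intro: L1_prim)

lemma prim_funpow_continuous: "continuous_on {0..1} w \<Longrightarrow> continuous_on {0..1} ((prim ^^ j) w)"
  by (induction j) (auto intro: continuous_on_prim L1_continuous)

lemma prim_funpow_add:
  assumes "u \<in> L1" "v \<in> L1"
  shows "x \<in> {0..1} \<Longrightarrow> (prim ^^ j) (\<lambda>x. u x + v x) x = (prim ^^ j) u x + (prim ^^ j) v x"
proof (induction j arbitrary: x)
  case (Suc j)
  have "prim ((prim ^^ j) (\<lambda>x. u x + v x)) x = prim (\<lambda>x. (prim ^^ j) u x + (prim ^^ j) v x) x"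
    by (rule prim_cong[OF Suc.IH Suc.prems])
  then show ?case using prim_add[OF prim_funpow_L1 prim_funpow_L1] assms Suc.prems by simp
qed simp

lemma prim_funpow_diff:
  assumes "u \<in> L1" "v \<in> L1" "x \<in> {0..1}"
  shows "(prim ^^ j) (\<lambda>x. u x - v x) x = (prim ^^ j) u x - (prim ^^ j) v x"
  using prim_funpow_add[OF L1_diff[OF assms(1,2)] assms(2,3), of j] by simp

lemma prim_funpow_cong:
  assumes "\<And>x. x \<in> {0..1} \<Longrightarrow> u x = v x"
  shows "x \<in> {0..1} \<Longrightarrow> (prim ^^ j) u x = (prim ^^ j) v x"
  by (induction j arbitrary: x) (auto intro: prim_cong assms)

text \<open>The weight is nondecreasing and the interval has length at most 1, so integration
  preserves the bound.\<close>

lemma norm_prim_funpow_le: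
  assumes C: "C \<ge> 0" and B: "B \<ge> 0" and u: "u \<in> L1"
    and ub: "\<And>x. x \<in> {0..1} \<Longrightarrow> norm (u x) \<le> B * exp (C * x)"
  shows "x \<in> {0..1} \<Longrightarrow> norm ((prim ^^ j) u x) \<le> B * exp (C * x)"
proof (induction j arbitrary: x)
  case (Suc j)
  have "norm (prim ((prim ^^ j) u) x) \<le> integral {0..x} (\<lambda>s. B * exp (C * x))"
    unfolding prim_def[of "(prim ^^ j) u"]
  proof (rule integral_norm_bound_integral)
    show "(prim ^^ j) u integrable_on {0..x}"
      by (rule L1_integrable_sub[OF prim_funpow_L1[OF u] Suc.prems])
    fix s assume s: "s \<in> {0..x}"
    then have "norm ((prim ^^ j) u s) \<le> B * exp (C * s)" using Suc by auto
    also have "\<dots> \<le> B * exp (C * x)" using s B C by (auto intro!: mult_left_mono)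
    finally show "norm ((prim ^^ j) u s) \<le> B * exp (C * x)" .
  qed (rule integrable_const_ivl)
  also have "\<dots> = x * (B * exp (C * x))" using Suc.prems by simp
  also have "\<dots> \<le> 1 * (B * exp (C * x))" using Suc.prems B by (intro mult_right_mono) auto
  finally show ?case by simp
qed (use ub in simp)

section \<open>Density of the domain\<close>

text \<open>The row sum of the perturbation \<open>(prim ^^ m) w\<close>, whose derivative of order
  j - 1 is the iterated primitive of \<open>w\<close> of order m + 1 - j.\<close>

definition row_op :: "nat \<Rightarrow> matrix_fun \<Rightarrow> (real \<Rightarrow> complex) \<Rightarrow> nat \<Rightarrow> real \<Rightarrow> complex" where
  "row_op m F w k x = (\<Sum>j\<in>{1..m + 1}. F k j x * (prim ^^ (m + 1 - j)) w x)"

lemma matrix_class_L1: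
  "F \<in> matrix_class m \<Longrightarrow> k \<in> {m + 1..2 * m + 1} \<Longrightarrow> j \<in> {1..m + 1} \<Longrightarrow> F k j \<in> L1"
  unfolding matrix_class_def by blast

lemma row_op_L1:
  assumes "F \<in> matrix_class m" "k \<in> {m + 1..2 * m + 1}" "continuous_on {0..1} w"
  shows "row_op m F w k \<in> L1"
  unfolding row_op_def using assms
  by (intro L1_sum L1_mult_continuous matrix_class_L1 prim_funpow_continuous)

text \<open>Row k enters the equation for w' with k - m - 1 integrations. Integrating that equation
  once more gives the exponent k - m, which is at least 1.\<close>

definition volterra_op :: "nat \<Rightarrow> matrix_fun \<Rightarrow> (real \<Rightarrow> complex) \<Rightarrow> real \<Rightarrow> complex" where
  "volterra_op m F w x = (\<Sum>k\<in>{m + 1..2 * m + 1}. (prim ^^ (k - m)) (row_op m F w k) x)"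

lemma continuous_on_volterra_op:
  assumes F: "F \<in> matrix_class m" and w: "continuous_on {0..1} w"
  shows "continuous_on {0..1} (volterra_op m F w)"
  unfolding volterra_op_def
proof (rule continuous_on_sum)
  fix k assume k: "k \<in> {m + 1..2 * m + 1}"
  then have "k - m = Suc (k - m - 1)" by auto
  then show "continuous_on {0..1} ((prim ^^ (k - m)) (row_op m F w k))"
    using continuous_on_prim[OF prim_funpow_L1[OF row_op_L1[OF F k w]], of "k - m - 1"] by simp
qed

lemma volterra_op_diff:
  assumes F: "F \<in> matrix_class m" and u: "continuous_on {0..1} u" and v: "continuous_on {0..1} v"
    and x: "x \<in> {0..1}"
  shows "volterra_op m F (\<lambda>x. u x - v x) x = volterra_op m F u x - volterra_op m F v x"
proof -
  have row: "row_op m F (\<lambda>x. u x - v x) k x = row_op m F u k x - row_op m F v k x" if "x \<in> {0..1}" for k x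
    unfolding row_op_def
    by (simp add: prim_funpow_diff[OF L1_continuous[OF u] L1_continuous[OF v] that] right_diff_distrib
        sum_subtractf del: sum.cl_ivl_Suc)
  have "(prim ^^ (k - m)) (row_op m F (\<lambda>x. u x - v x) k) x
      = (prim ^^ (k - m)) (row_op m F u k) x - (prim ^^ (k - m)) (row_op m F v k) x"
    if k: "k \<in> {m + 1..2 * m + 1}" for k
    using prim_funpow_cong[OF row[where k=k] x]
      prim_funpow_diff[OF row_op_L1[OF F k u] row_op_L1[OF F k v] x] by simp
  then show ?thesis unfolding volterra_op_def by (simp add: sum_subtractf del: sum.cl_ivl_Suc)
qed

text \<open>The first integration after multiplying by the matrix entries gains the small factor
  \<delta> from \<open>exp_weight\<close>. All other integrations, before and after, preserve the
  weighted bound.\<close>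

lemma volterra_op_bound:
  assumes F: "F \<in> matrix_class m"
  shows "\<exists>C\<ge>0. \<forall>w B. continuous_on {0..1} w \<longrightarrow> B \<ge> 0 \<longrightarrow>
    (\<forall>x\<in>{0..1}. norm (w x) \<le> B * exp (C * x)) \<longrightarrow>
    (\<forall>x\<in>{0..1}. norm (volterra_op m F w x) \<le> B / 2 * exp (C * x))"
proof -
  \<comment> \<open>There are m + 1 rows, and together they must give the factor 1/2.\<close>
  define \<delta> where "\<delta> = 1 / (2 * real (m + 1))"
  have \<delta>: "\<delta> > 0" by (simp add: \<delta>_def)
  \<comment> \<open>One function dominating the entries of all rows, so that a single weight serves
    them all. It is complex-valued to match \<open>exp_weight\<close>.\<close>
  define a where "a x = (\<Sum>k\<in>{m + 1..2 * m + 1}. \<Sum>j\<in>{1..m + 1}. complex_of_real (norm (F k j x)))" for x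
  have na: "norm (a x) = (\<Sum>k\<in>{m + 1..2 * m + 1}. \<Sum>j\<in>{1..m + 1}. norm (F k j x))" for x
  proof -
    have "a x = complex_of_real (\<Sum>k\<in>{m + 1..2 * m + 1}. \<Sum>j\<in>{1..m + 1}. norm (F k j x))"
      unfolding a_def by (simp only: of_real_sum)
    then show ?thesis by (simp only: norm_of_real abs_of_nonneg sum_nonneg norm_ge_zero)
  qed
  have "(\<lambda>x. complex_of_real (norm (F k j x))) \<in> L1" if "k \<in> {m + 1..2 * m + 1}" "j \<in> {1..m + 1}" for k j
  proof -
    have "(\<lambda>x. norm (F k j x)) absolutely_integrable_on {0..1}"
      using matrix_class_L1[OF F that] unfolding L1_def by (simp add: set_integrable_norm)
    from absolutely_integrable_linear[OF this bounded_linear_of_real[where 'a=complex]]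
    show ?thesis unfolding L1_def by (simp add: o_def)
  qed
  then have aL: "a \<in> L1" unfolding a_def by (intro L1_sum)
  obtain C where C: "C \<ge> 0"
    and weight: "\<And>t. t \<in> {0..1} \<Longrightarrow> integral {0..t} (\<lambda>s. norm (a s) * exp (C * s)) \<le> \<delta> * exp (C * t)"
    using exp_weight[OF aL \<delta>] by metis
  have "norm (volterra_op m F w x) \<le> B / 2 * exp (C * x)"
    if w: "continuous_on {0..1} w" and B: "B \<ge> 0"
      and wB: "\<And>x. x \<in> {0..1} \<Longrightarrow> norm (w x) \<le> B * exp (C * x)" and x: "x \<in> {0..1}" for w B x
  proof -
    have row: "norm (row_op m F w k s) \<le> B * (norm (a s) * exp (C * s))"
      if k: "k \<in> {m + 1..2 * m + 1}" and s: "s \<in> {0..1}" for k s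
    proof -
      have "norm (row_op m F w k s) \<le> (\<Sum>j\<in>{1..m + 1}. norm (F k j s) * (B * exp (C * s)))"
        unfolding row_op_def
      proof (rule sum_norm_le)
        fix j
        have "norm ((prim ^^ (m + 1 - j)) w s) \<le> B * exp (C * s)"
          by (rule norm_prim_funpow_le[OF C B L1_continuous[OF w] wB s])
        then show "norm (F k j s * (prim ^^ (m + 1 - j)) w s) \<le> norm (F k j s) * (B * exp (C * s))"
          unfolding norm_mult by (rule mult_left_mono) simp
      qed
      also have "\<dots> = (\<Sum>j\<in>{1..m + 1}. norm (F k j s)) * (B * exp (C * s))"
        by (rule sum_distrib_right[symmetric])
      also have "\<dots> \<le> norm (a s) * (B * exp (C * s))"
      proof (rule mult_right_mono)
        show "(\<Sum>j\<in>{1..m + 1}. norm (F k j s)) \<le> norm (a s)"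
          unfolding na by (rule member_le_sum[OF k]) (intro sum_nonneg norm_ge_zero, simp)
      qed (use B in simp)
      finally show ?thesis by (simp add: mult_ac)
    qed
    have p: "norm ((prim ^^ (k - m)) (row_op m F w k) x) \<le> B * \<delta> * exp (C * x)"
      if k: "k \<in> {m + 1..2 * m + 1}" for k
    proof -
      have RL: "row_op m F w k \<in> L1" by (rule row_op_L1[OF F k w])
      have one: "norm (prim (row_op m F w k) t) \<le> B * \<delta> * exp (C * t)" if t: "t \<in> {0..1}" for t
      proof -
        have "(\<lambda>s. a s * complex_of_real (exp (C * s))) \<in> L1"
          by (rule L1_mult_continuous[OF aL]) (intro continuous_intros)
        from L1_norm_integrable_sub[OF this t]
        have ai: "(\<lambda>s. norm (a s) * exp (C * s)) integrable_on {0..t}" by (simp add: norm_mult)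
        have "norm (prim (row_op m F w k) t) \<le> integral {0..t} (\<lambda>s. B * (norm (a s) * exp (C * s)))"
          unfolding prim_def using t
          by (intro integral_norm_bound_integral L1_integrable_sub[OF RL t] integrable_on_mult_right ai row[OF k]) auto
        also have "\<dots> = B * integral {0..t} (\<lambda>s. norm (a s) * exp (C * s))" by simp
        also have "\<dots> \<le> B * (\<delta> * exp (C * t))" by (intro mult_left_mono weight t B)
        finally show ?thesis by simp
      qed
      have "norm ((prim ^^ (k - m - 1)) (prim (row_op m F w k)) x) \<le> B * \<delta> * exp (C * x)"
        using B \<delta> by (intro norm_prim_funpow_le[OF C _ L1_prim[OF RL] one x]) auto
      moreover have "k - m = Suc (k - m - 1)" using k by auto
      ultimately show ?thesis by (metis funpow_swap1 funpow.simps(2) o_apply)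
    qed
    have "norm (volterra_op m F w x) \<le> (\<Sum>k\<in>{m + 1..2 * m + 1}. B * \<delta> * exp (C * x))"
      unfolding volterra_op_def by (rule sum_norm_le[OF p])
    also have "\<dots> = real (m + 1) * (B * \<delta> * exp (C * x))" by simp
    also have "\<dots> = B / 2 * exp (C * x)" by (simp add: \<delta>_def field_simps)
    finally show ?thesis .
  qed
  then show ?thesis using C by (intro exI[of _ C]) blast
qed

lemma has_L1_deriv_smooth:
  assumes "smooth f" shows "has_L1_deriv f (cderiv f)"
proof -
  have c: "continuous_on {0..1} (cderiv f)" by (rule smooth_continuous_on[OF smooth_cderiv[OF assms]])
  have "prim (cderiv f) x = f x - f 0" if "x \<in> {0..1}" for x
  proof -
    have "(cderiv f has_integral f x - f 0) {0..x}"
      using that smooth_has_vector_derivative[OF assms]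
      by (intro fundamental_theorem_of_calculus) (auto intro: has_vector_derivative_at_within)
    then show ?thesis unfolding prim_def by (rule integral_unique)
  qed
  then have "(\<lambda>x. f 0 + prim (cderiv f) x) \<simeq> f" by (intro ae_eqI) simp
  from has_L1_deriv_cong[OF this] show ?thesis
    using has_L1_deriv_prim[OF L1_continuous[OF c], of "f 0"] by simp
qed

lemma has_L1_deriv_prim0: "h \<in> L1 \<Longrightarrow> has_L1_deriv (prim h) h"
  using has_L1_deriv_prim[of h 0] by simp

lemma smooth_funpow_cderiv: "smooth f \<Longrightarrow> smooth ((cderiv ^^ k) f)"
  by (induction k) (auto intro: smooth_cderiv)

text \<open>Only the L_1 norm of P - u is made small, so w' need not be uniformly small. But
  \<open>w\<close> is, since the equation sees P - u only through its primitive. This is why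
  closeness is obtained for the derivatives up to order m.\<close>

lemma quasi_domain_dense:
  assumes F: "F \<in> matrix_class m" and y: "y \<in> sob (Suc m)" and e: "e > 0"
  obtains w where "continuous_on {0..1} w" "\<And>x. x \<in> {0..1} \<Longrightarrow> norm (w x) \<le> e"
    "(\<lambda>x. y x + (prim ^^ m) w x) \<in> quasi_domain m F"
    "\<And>i. i \<le> m \<Longrightarrow> (L1_deriv ^^ i) (\<lambda>x. y x + (prim ^^ m) w x)
       \<simeq> (\<lambda>x. (L1_deriv ^^ i) y x + (prim ^^ (m - i)) w x)"
proof -
  from volterra_op_bound[OF F] obtain C where C: "C \<ge> 0" and bound: "\<forall>w B. continuous_on {0..1} w \<longrightarrow> B \<ge> 0 \<longrightarrow>
      (\<forall>x\<in>{0..1}. norm (w x) \<le> B * exp (C * x)) \<longrightarrow>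
      (\<forall>x\<in>{0..1}. norm (volterra_op m F w x) \<le> B / 2 * exp (C * x))"
    by (elim exE conjE)
  let ?I = "{m + 1..2 * m + 1}"
  define R where "R = row_sum m F y"
  have RL: "R k \<in> L1" if "k \<in> ?I" for k
    unfolding R_def using that by (intro row_sum_L1 F y) auto
  \<comment> \<open>The combination whose m-th distributional derivative is L_F(y).\<close>
  define u where "u x = (L1_deriv ^^ Suc m) y x - (\<Sum>k\<in>?I. (prim ^^ (k - m - 1)) (R k) x)" for x
  have yL: "(L1_deriv ^^ i) y \<in> L1" if "i \<le> Suc m" for i by (rule sob_L1[OF y that])
  have sL: "(\<lambda>x. \<Sum>k\<in>?I. (prim ^^ (k - m - 1)) (R k) x) \<in> L1"
    by (intro L1_sum prim_funpow_L1 RL)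
  have uL: "u \<in> L1" unfolding u_def by (rule L1_diff[OF yL[OF order_refl] sL])
  \<comment> \<open>The Volterra solution is bounded by \<open>2 * \<epsilon> * exp C\<close>, which
    this choice makes equal to \<open>e\<close>.\<close>
  define \<epsilon> where "\<epsilon> = e / (2 * exp C)"
  have \<epsilon>: "\<epsilon> > 0" using e by (simp add: \<epsilon>_def)
  obtain P where P: "polynomial_function P" and Pu: "integral {0..1} (\<lambda>x. norm (P x - u x)) < \<epsilon>"
    using L1_polynomial_approx[OF uL \<epsilon>] by blast
  have Ps: "smooth ((cderiv ^^ i) P)" for i
    by (intro smooth_funpow_cderiv polynomial_function_smooth P)
  have PuL: "(\<lambda>x. P x - u x) \<in> L1"
    by (intro L1_diff uL L1_continuous continuous_polynomial_function P)
  obtain w where w: "continuous_on {0..1} w"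
    and weq: "\<And>x. x \<in> {0..1} \<Longrightarrow> w x = prim (\<lambda>x. P x - u x) x + volterra_op m F w x"
    and wb: "\<And>x. x \<in> {0..1} \<Longrightarrow> norm (w x) \<le> 2 * \<epsilon> * exp C"
  proof (rule volterra_solution[where K="volterra_op m F" and C=C and h="prim (\<lambda>x. P x - u x)" and e=\<epsilon>])
    show "norm (prim (\<lambda>x. P x - u x) x) \<le> \<epsilon>" if "x \<in> {0..1}" for x
      using norm_prim_le[OF PuL that] Pu by simp
    show "norm (volterra_op m F w x) \<le> B / 2 * exp (C * x)"
      if "continuous_on {0..1} w" "B \<ge> 0" "\<And>x. x \<in> {0..1} \<Longrightarrow> norm (w x) \<le> B * exp (C * x)" "x \<in> {0..1}" for w B x
      using bound that by blast
  qed (use C \<epsilon> that in \<open>auto intro: continuous_on_volterra_op[OF F] volterra_op_diff[OF F] continuous_on_prim[OF PuL]\<close>)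
  have wL: "w \<in> L1" by (rule L1_continuous[OF w])
  define S where "S = row_op m F w"
  have SL: "S k \<in> L1" if "k \<in> ?I" for k unfolding S_def by (rule row_op_L1[OF F that w])
  have ISL: "(prim ^^ j) (S k) \<in> L1" if "k \<in> ?I" for j k by (intro prim_funpow_L1 SL that)
  \<comment> \<open>The Volterra equation differentiated term by term: k - m integrations become k -
    m - 1.\<close>
  define w' where "w' x = (P x - u x) + (\<Sum>k\<in>?I. (prim ^^ (k - m - 1)) (S k) x)" for x
  have w'L: "w' \<in> L1" unfolding w'_def by (intro L1_add PuL L1_sum ISL)
  have wd: "has_L1_deriv w w'"
  proof -
    have 1: "has_L1_deriv (\<lambda>x. prim (\<lambda>x. P x - u x) x + (\<Sum>k\<in>?I. prim ((prim ^^ (k - m - 1)) (S k)) x)) w'"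
      unfolding w'_def
      by (intro has_L1_deriv_add has_L1_deriv_sum L1_sum conjI L1_prim has_L1_deriv_prim0 PuL ISL)
    have 2: "(\<lambda>x. prim (\<lambda>x. P x - u x) x + (\<Sum>k\<in>?I. prim ((prim ^^ (k - m - 1)) (S k)) x)) \<simeq> w"
    proof (rule ae_eqI)
      fix x :: real assume x: "x \<in> {0..1}"
      have "prim ((prim ^^ (k - m - 1)) (S k)) x = (prim ^^ (k - m)) (S k) x" if "k \<in> ?I" for k
      proof -
        have "k - m = Suc (k - m - 1)" using that by auto
        then show ?thesis by (metis funpow.simps(2) o_apply)
      qed
      then show "prim (\<lambda>x. P x - u x) x + (\<Sum>k\<in>?I. prim ((prim ^^ (k - m - 1)) (S k)) x) = w x"
        unfolding weq[OF x] volterra_op_def S_def[symmetric] by (metis (no_types, lifting) sum.cong)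
    qed
    show ?thesis using 1 unfolding has_L1_deriv_cong[OF 2] .
  qed
  define Y where "Y x = y x + (prim ^^ m) w x" for x
  \<comment> \<open>Explicit representatives of the derivatives of \<open>Y\<close>; at order m + 1
    the primitives of \<open>w\<close> are used up and w' appears.\<close>
  define v where "v i = (if i \<le> m then (\<lambda>x. (L1_deriv ^^ i) y x + (prim ^^ (m - i)) w x)
      else (\<lambda>x. (L1_deriv ^^ Suc m) y x + w' x))" for i
  have Y: "Y \<in> sob (Suc m)" and Yv: "\<And>i. i \<le> Suc m \<Longrightarrow> (L1_deriv ^^ i) Y \<simeq> v i"
  proof -
    have 0: "Y \<simeq> v 0" by (simp add: v_def Y_def[abs_def])
    have 1: "v (Suc m) \<in> L1" unfolding v_def using L1_add[OF yL[OF order_refl] w'L] by simp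
    have 2: "v i \<in> L1 \<and> has_L1_deriv (v i) (v (Suc i))" if i: "i < Suc m" for i
    proof -
      have a: "has_L1_deriv ((L1_deriv ^^ i) y) ((L1_deriv ^^ Suc i) y)"
        using has_L1_deriv_L1_deriv[OF sob_W11[OF y i]] by simp
      have yi: "(L1_deriv ^^ i) y \<in> L1" using yL i by simp
      have vi: "v i = (\<lambda>x. (L1_deriv ^^ i) y x + (prim ^^ (m - i)) w x)" using i by (simp add: v_def)
      have pi: "(prim ^^ (m - i)) w \<in> L1" by (rule prim_funpow_L1[OF wL])
      show ?thesis
      proof (cases "i = m")
        case True
        then have "v (Suc i) = (\<lambda>x. (L1_deriv ^^ Suc i) y x + w' x)" by (simp add: v_def)
        then show ?thesis using has_L1_deriv_add[OF yi wL a wd] L1_add[OF yi wL] vi True by simp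
      next
        case False
        then have j: "m - i = Suc (m - Suc i)" using i by auto
        have vs: "v (Suc i) = (\<lambda>x. (L1_deriv ^^ Suc i) y x + (prim ^^ (m - Suc i)) w x)"
          using False i by (simp add: v_def)
        have "has_L1_deriv ((prim ^^ (m - i)) w) ((prim ^^ (m - Suc i)) w)"
          unfolding j using has_L1_deriv_prim0[OF prim_funpow_L1[OF wL]] by simp
        from has_L1_deriv_add[OF yi pi a this] show ?thesis
          using L1_add[OF yi pi] unfolding vi vs by blast
      qed
    qed
    show "Y \<in> sob (Suc m)" by (rule sob_chain(1)[OF 0 1 2])
    show "(L1_deriv ^^ i) Y \<simeq> v i" if "i \<le> Suc m" for i by (rule sob_chain(2)[OF 0 1 2 that])
  qed
  define T where "T k x = R k x + S k x" for k x
  have TL: "T k \<in> L1" if "k \<in> ?I" for k unfolding T_def by (intro L1_add RL SL that)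
  have rowT: "row_sum m F Y k \<simeq> T k" if k: "k \<in> ?I" for k
  proof -
    have nk: "\<not> k \<le> m" using k by simp
    have "row_sum m F Y k \<simeq> (\<lambda>x. \<Sum>j\<in>{1..m + 1}. F k j x * v (j - 1) x)"
      unfolding row_sum_def if_not_P[OF nk] by (intro ae_eq_sum ae_eq_mult ae_eq_refl Yv) auto
    moreover have "(\<Sum>j\<in>{1..m + 1}. F k j x * v (j - 1) x) = T k x" for x
    proof -
      have "(\<Sum>j\<in>{1..m + 1}. F k j x * v (j - 1) x)
        = (\<Sum>j\<in>{1..m + 1}. F k j x * (L1_deriv ^^ (j - 1)) y x + F k j x * (prim ^^ (m + 1 - j)) w x)"
        by (rule sum.cong) (auto simp: v_def distrib_left)
      then show ?thesis
        unfolding T_def R_def S_def row_sum_def row_op_def if_not_P[OF nk] by (simp only: sum.distrib)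
    qed
    ultimately show ?thesis by simp
  qed
  \<comment> \<open>The i-th derivative of P plus the iterated primitives of the rows
    \<open>T k\<close>, without the terms k \<le> m + i, which the rows subtracted earlier have
    removed.\<close>
  define q where "q i x = (cderiv ^^ i) P x + (\<Sum>k\<in>{m + 1 + i..2 * m + 1}. (prim ^^ (k - m - 1 - i)) (T k) x)" for i x
  \<comment> \<open>Here the equation for \<open>w\<close> pays off: in y^{(m+1)} + w' the
    non-smooth part of \<open>u\<close> cancels, leaving P and primitives of the combined rows
    \<open>T\<close>.\<close>
  have q0: "v (Suc m) \<simeq> q 0"
  proof (rule ae_eqI)
    fix x :: real assume x: "x \<in> {0..1}"
    have "(prim ^^ j) (T k) x = (prim ^^ j) (R k) x + (prim ^^ j) (S k) x" if "k \<in> ?I" for j k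
      unfolding T_def by (rule prim_funpow_add[OF RL[OF that] SL[OF that] x])
    then have "(\<Sum>k\<in>?I. (prim ^^ (k - m - 1)) (T k) x) =
      (\<Sum>k\<in>?I. (prim ^^ (k - m - 1)) (R k) x) + (\<Sum>k\<in>?I. (prim ^^ (k - m - 1)) (S k) x)"
      unfolding sum.distrib[symmetric] by (intro sum.cong) auto
    then show "v (Suc m) x = q 0 x"
      unfolding v_def q_def w'_def u_def by (simp del: sum.cl_ivl_Suc funpow.simps)
  qed
  have low: "quasi_distr m F Y k \<doteq> distr_of ((L1_deriv ^^ k) Y)" if "k \<le> m" for k
    using that
  proof (induction k)
    case (Suc k)
    have "row_sum m F Y (Suc k) \<simeq> (\<lambda>x. 0)"
      using Suc.prems by (intro ae_eqI) (simp add: row_sum_def)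
    from quasi_distr_Suc[OF Suc.IH has_L1_deriv_L1_deriv[OF sob_W11[OF Y]] this L1_const]
    show ?case using Suc.prems by simp
  qed (simp add: distr_eq_def)
  have high: "quasi_distr m F Y (m + 1 + i) \<doteq> distr_of (\<lambda>x. q i x - T (m + 1 + i) x)" if "i \<le> m" for i
    using that
  proof (induction i)
    case 0
    have "has_L1_deriv ((L1_deriv ^^ m) Y) ((L1_deriv ^^ Suc m) Y)"
      using has_L1_deriv_L1_deriv[OF sob_W11[OF Y, of m]] by simp
    from has_L1_deriv_cong_right[OF this ae_eq_trans[OF Yv[OF order_refl] q0]]
    have "has_L1_deriv ((L1_deriv ^^ m) Y) (q 0)" .
    from quasi_distr_Suc[OF low[OF order_refl] this rowT TL] show ?case by simp
  next
    case (Suc i)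
    have i: "m + 1 + i \<in> ?I" "m + 1 + Suc i \<in> ?I" using Suc.prems by auto
    \<comment> \<open>The term k = m + 1 + i has no integration left and is exactly the row
      subtracted at this stage, so what remains can be differentiated once more.\<close>
    have split: "{m + 1 + i..2 * m + 1} = insert (m + 1 + i) {m + 1 + Suc i..2 * m + 1}"
      using Suc.prems by auto
    have L: "(prim ^^ j) (T k) \<in> L1" if "k \<in> {m + 1 + Suc i..2 * m + 1}" for j k
      using that by (intro prim_funpow_L1 TL) auto
    have "has_L1_deriv (\<lambda>x. (cderiv ^^ i) P x
        + (\<Sum>k\<in>{m + 1 + Suc i..2 * m + 1}. prim ((prim ^^ (k - m - 1 - Suc i)) (T k)) x)) (q (Suc i))"
      unfolding q_def funpow.simps(2) o_apply
      by (intro has_L1_deriv_add has_L1_deriv_sum L1_sum conjI L1_prim has_L1_deriv_prim0 L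
          has_L1_deriv_smooth Ps L1_continuous[OF smooth_continuous_on])
    moreover have "(\<lambda>x. (cderiv ^^ i) P x
        + (\<Sum>k\<in>{m + 1 + Suc i..2 * m + 1}. prim ((prim ^^ (k - m - 1 - Suc i)) (T k)) x))
      = (\<lambda>x. q i x - T (m + 1 + i) x)"
    proof
      fix x
      have "prim ((prim ^^ (k - m - 1 - Suc i)) (T k)) x = (prim ^^ (k - m - 1 - i)) (T k) x"
        if "k \<in> {m + 1 + Suc i..2 * m + 1}" for k
      proof -
        have "k - m - 1 - i = Suc (k - m - 1 - Suc i)" using that by auto
        then show ?thesis by (metis funpow.simps(2) o_apply)
      qed
      then have 1: "(\<Sum>k\<in>{m + 1 + Suc i..2 * m + 1}. prim ((prim ^^ (k - m - 1 - Suc i)) (T k)) x)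
        = (\<Sum>k\<in>{m + 1 + Suc i..2 * m + 1}. (prim ^^ (k - m - 1 - i)) (T k) x)"
        by (rule sum.cong[OF refl])
      have 2: "(\<Sum>k\<in>{m + 1 + i..2 * m + 1}. (prim ^^ (k - m - 1 - i)) (T k) x)
        = T (m + 1 + i) x + (\<Sum>k\<in>{m + 1 + Suc i..2 * m + 1}. (prim ^^ (k - m - 1 - i)) (T k) x)"
        unfolding split by (subst sum.insert) (auto simp del: sum.cl_ivl_Suc)
      show "(cderiv ^^ i) P x
        + (\<Sum>k\<in>{m + 1 + Suc i..2 * m + 1}. prim ((prim ^^ (k - m - 1 - Suc i)) (T k)) x)
        = q i x - T (m + 1 + i) x" 
        unfolding q_def 1 2 by (simp only: eq_diff_eq ac_simps)
    qed
    ultimately have d: "has_L1_deriv (\<lambda>x. q i x - T (m + 1 + i) x) (q (Suc i))" by simp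
    have "quasi_distr m F Y (m + 1 + i) \<doteq> distr_of (\<lambda>x. q i x - T (m + 1 + i) x)"
      using Suc by simp
    from quasi_distr_Suc[OF this d] rowT[OF i(2)] TL[OF i(2)] show ?case by simp
  qed
  have "q m \<in> L1" unfolding q_def
    by (intro L1_add L1_sum prim_funpow_L1 TL L1_continuous[OF smooth_continuous_on[OF Ps]]) auto
  then have "(\<lambda>x. q m x - T (m + 1 + m) x) \<in> L1" by (intro L1_diff TL) auto
  moreover have "quasi_distr m F Y (2 * m + 1) \<doteq> distr_of (\<lambda>x. q m x - T (m + 1 + m) x)"
    using high[of m] by (simp add: mult_2 add.commute)
  ultimately have dom: "Y \<in> quasi_domain m F" by (rule quasi_domainI[OF F Y])
  show thesis
  proof (rule that[OF w])
    show "norm (w x) \<le> e" if "x \<in> {0..1}" for x using wb[OF that] by (simp add: \<epsilon>_def)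
    show "(\<lambda>x. y x + (prim ^^ m) w x) \<in> quasi_domain m F" using dom unfolding Y_def .
    show "(L1_deriv ^^ i) (\<lambda>x. y x + (prim ^^ m) w x) \<simeq> (\<lambda>x. (L1_deriv ^^ i) y x + (prim ^^ (m - i)) w x)"
      if "i \<le> m" for i
      using Yv[of i] that unfolding Y_def v_def by simp
  qed
qed

section \<open>Extension from the domain and comparison of two matrices\<close>

lemma norm_prim_funpow_le_const:
  assumes "B \<ge> 0" "u \<in> L1" "\<And>x. x \<in> {0..1} \<Longrightarrow> norm (u x) \<le> B" "x \<in> {0..1}"
  shows "norm ((prim ^^ j) u x) \<le> B"
  using norm_prim_funpow_le[of 0 B u x j] assms by simp

text \<open>Moving \<open>y\<close> into the domain changes each term by the integral of an L_1
  weight against a function of size at most \<open>e\<close>. In total this is at most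
  \<open>e\<close> times the sum \<open>A\<close> of the L_1 norms of the weights.\<close>

lemma L1_functional_vanish:
  assumes F: "F \<in> matrix_class m" and \<Phi>: "L1_functional m \<Phi>"
    and zero: "\<And>y. y \<in> quasi_domain m F \<Longrightarrow> \<Phi> y = 0" and y: "y \<in> sob (Suc m)"
  shows "\<Phi> y = 0"
proof -
  obtain \<omega> where \<omega>: "\<And>i. i \<le> m \<Longrightarrow> \<omega> i \<in> L1"
    and eq: "\<And>y. y \<in> sob (Suc m) \<Longrightarrow> \<Phi> y = (\<Sum>i\<le>m. integral {0..1} (\<lambda>x. \<omega> i x * (L1_deriv ^^ i) y x))"
    by (rule L1_functionalE[OF \<Phi>], rule that)
  define A where "A = (\<Sum>i\<le>m. integral {0..1} (\<lambda>x. norm (\<omega> i x)))"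
  have A: "A \<ge> 0" unfolding A_def
    by (intro sum_nonneg integral_nonneg L1_norm_integrable \<omega>) auto
  have *: "norm (\<Phi> y) \<le> e * A" if e: "e > 0" for e
  proof -
    obtain w where w: "continuous_on {0..1} w" "\<And>x. x \<in> {0..1} \<Longrightarrow> norm (w x) \<le> e"
      and Y: "(\<lambda>x. y x + (prim ^^ m) w x) \<in> quasi_domain m F"
      and Yi: "\<And>i. i \<le> m \<Longrightarrow> (L1_deriv ^^ i) (\<lambda>x. y x + (prim ^^ m) w x)
       \<simeq> (\<lambda>x. (L1_deriv ^^ i) y x + (prim ^^ (m - i)) w x)"
      by (rule quasi_domain_dense[OF F y e], rule that)
    define E where "E i = integral {0..1} (\<lambda>x. \<omega> i x * (prim ^^ (m - i)) w x)" for i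
    have c: "continuous_on {0..1} ((prim ^^ (m - i)) w)" for i by (rule prim_funpow_continuous[OF w(1)])
    have "integral {0..1} (\<lambda>x. \<omega> i x * (L1_deriv ^^ i) (\<lambda>x. y x + (prim ^^ m) w x) x)
       = integral {0..1} (\<lambda>x. \<omega> i x * (L1_deriv ^^ i) y x) + E i" if i: "i \<le> m" for i
    proof -
      have "integral {0..1} (\<lambda>x. \<omega> i x * (L1_deriv ^^ i) (\<lambda>x. y x + (prim ^^ m) w x) x)
        = integral {0..1} (\<lambda>x. \<omega> i x * ((L1_deriv ^^ i) y x + (prim ^^ (m - i)) w x))"
        by (intro integral_cong_ae_eq ae_eq_mult ae_eq_refl Yi i)
      also have "\<dots> = integral {0..1} (\<lambda>x. \<omega> i x * (L1_deriv ^^ i) y x) + E i"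
        unfolding E_def distrib_left
        by (intro integral_add L1_integrable L1_mult_sob[OF \<omega> y] L1_mult_continuous \<omega> c i)
      finally show ?thesis .
    qed
    then have "\<Phi> (\<lambda>x. y x + (prim ^^ m) w x) = \<Phi> y + (\<Sum>i\<le>m. E i)"
      using eq[OF y] eq[OF quasi_domain_sob[OF F Y]] by (simp add: sum.distrib)
    then have "norm (\<Phi> y) = norm (\<Sum>i\<le>m. E i)"
      using zero[OF Y] by (metis add_eq_0_iff norm_minus_cancel)
    also have "\<dots> \<le> (\<Sum>i\<le>m. e * integral {0..1} (\<lambda>x. norm (\<omega> i x)))"
    proof (rule sum_norm_le)
      fix i assume "i \<in> {..m}"
      then have i: "i \<le> m" by simp
      show "norm (E i) \<le> e * integral {0..1} (\<lambda>x. norm (\<omega> i x))"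
        unfolding E_def using e
        by (intro integral_mult_bound \<omega> i c norm_prim_funpow_le_const[OF _ L1_continuous[OF w(1)] w(2)]) auto
    qed
    also have "\<dots> = e * A" unfolding A_def by (rule sum_distrib_left[symmetric])
    finally show ?thesis .
  qed
  have "norm (\<Phi> y) \<le> 0"
  proof (rule field_le_epsilon)
    fix d :: real assume d: "d > 0"
    \<comment> \<open>The denominator A + 1 covers the case A = 0.\<close>
    have "norm (\<Phi> y) \<le> d / (A + 1) * A" using d A by (intro *) simp
    also have "\<dots> \<le> d" using d A by (simp add: field_simps)
    finally show "norm (\<Phi> y) \<le> 0 + d" by simp
  qed
  then show ?thesis by simp
qed

text \<open>The two matrices have different roles. Density of the domain of \<open>G\<close> extends
  L_G = \<ell>_n to W_1^{m+1}, while \<open>F\<close> certifies that \<ell>_n(y) lies in L_1. Hence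
  L_G(y) lies in L_1, which puts \<open>y\<close> into the domain of \<open>G\<close>.\<close>

lemma quasi_domain_subset:
  assumes \<tau>: "\<tau> \<in> coeff_space m" and F: "F \<in> associated_matrices m \<tau>" and G: "G \<in> associated_matrices m \<tau>"
  shows "quasi_domain m F \<subseteq> quasi_domain m G"
proof
  fix y assume y: "y \<in> quasi_domain m F"
  have FC: "F \<in> matrix_class m" and GC: "G \<in> matrix_class m"
    using F G unfolding associated_matrices_def by auto
  have s: "y \<in> sob (Suc m)" by (rule quasi_domain_sob[OF FC y])
  have "quasi_distr m G y (2 * m + 1) \<doteq> distr_of (quasi_deriv F y (2 * m + 1))"
    unfolding distr_eq_def
  proof
    fix z assume z: "z \<in> test_funs"
    have "L1_functional m (\<lambda>y. diff_expr m \<tau> y z + (-1) * quasi_distr m G y (2 * m + 1) z)"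
      by (intro L1_functional_add L1_functional_cmult L1_functional_diff_expr L1_functional_quasi_distr \<tau> z GC) simp
    moreover have "diff_expr m \<tau> u z + (-1) * quasi_distr m G u (2 * m + 1) z = 0"
      if u: "u \<in> quasi_domain m G" for u
    proof -
      have "diff_expr m \<tau> u z = distr_of (quasi_deriv G u (2 * m + 1)) z"
        using G u z unfolding associated_matrices_def distr_eq_def by blast
      moreover have "quasi_distr m G u (2 * m + 1) z = distr_of (quasi_deriv G u (2 * m + 1)) z"
        using quasi_domain_imp(2)[OF GC u] z unfolding distr_eq_def by blast
      ultimately show ?thesis by simp
    qed
    ultimately have "diff_expr m \<tau> y z + (-1) * quasi_distr m G y (2 * m + 1) z = 0"
      by (rule L1_functional_vanish[OF GC _ _ s])
    then have "quasi_distr m G y (2 * m + 1) z = diff_expr m \<tau> y z"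
      by (simp del: quasi_distr.simps)
    also have "diff_expr m \<tau> y z = distr_of (quasi_deriv F y (2 * m + 1)) z"
      using F y z unfolding associated_matrices_def distr_eq_def by blast
    finally show "quasi_distr m G y (2 * m + 1) z = distr_of (quasi_deriv F y (2 * m + 1)) z" .
  qed
  then show "y \<in> quasi_domain m G"
    by (rule quasi_domainI[OF GC s quasi_domain_imp(1)[OF FC y]])
qed

theorem mainTheorem6:
  fixes m :: nat
    and \<tau> :: "nat \<Rightarrow> distr"
    and F G :: matrix_fun
  assumes "\<tau> \<in> coeff_space m"
    and "F \<in> associated_matrices m \<tau>"
    and "G \<in> associated_matrices m \<tau>"
  shows "quasi_domain m F = quasi_domain m G"
  using quasi_domain_subset[OF assms] quasi_domain_subset[OF assms(1,3,2)] by (rule equalityI)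

end
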